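(* Suppose that $\varphi$ is in $H^2_m(\mathbb{T}^d)$. Let $\mathbf{H}_{\varphi,k}$ denote the restriction of the Hankel operator $\mathbf{H}_\varphi$ to $H^2_k(\mathbb{T}^d)$ and let $\mathbf{0}$ denote the zero operator. (a) If $0\leq k\leq m$, then $\mathbf{H}_{\varphi,k}$ maps $H^2_k(\mathbb{T}^d)$ to $\overline{H^2_{m-k}}(\mathbb{T}^d)$. Moreover, $\mathbf{H}_\varphi$ enjoys the orthogonal decomposition \[\mathbf{H}_\varphi = \left(\bigoplus_{k=0}^m \mathbf{H}_{\varphi,k}\right)\oplus \mathbf{0}.\] (b) If $0\leq k\leq m$, then $\mathbf{H}_{\varphi,k}^\ast$ is unitarily equivalent to $\mathbf{H}_{\widetilde{\varphi},m-k}$ for $\widetilde{\varphi}(z)=\overline{\varphi(\overline{z})}$.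
   Context: $d\geq1$ and $m\geq0$ are integers. $\mathbb{T}^d$ is the $d$-dimensional torus with its normalized Haar measure. $H^2(\mathbb{T}^d)$ is the subspace of $L^2(\mathbb{T}^d)$ of functions whose Fourier coefficients are supported on $\mathbb{N}_0^d$, $\mathbb{N}_0=\{0,1,2,\ldots\}$, and $\overline{H^2}(\mathbb{T}^d)$ is the subspace of complex conjugates of functions in $H^2(\mathbb{T}^d)$. A function in $L^2(\mathbb{T}^d)$ is $m$-homogeneous if its Fourier coefficients are supported on frequencies $\alpha\in\mathbb{Z}^d$ with $\alpha_1+\cdots+\alpha_d=m$. $H^2_m(\mathbb{T}^d)$ is the subspace of $m$-homogeneous functions in $H^2(\mathbb{T}^d)$, and $\overline{H^2_m}(\mathbb{T}^d)$ is the space of complex conjugates of functions in $H^2_m(\mathbb{T}^d)$; thus $H^2(\mathbb{T}^d)=\bigoplus_{k\geq0}H^2_k(\mathbb{T}^d)$ and $\overline{H^2}(\mathbb{T}^d)=\bigoplus_{k\geq0}\overline{H^2_k}(\mathbb{T}^d)$ as orthogonal direct sums. Let $\overline{P}$ be the orthogonal projection from $L^2(\mathbb{T}^d)$ to $\overline{H^2}(\mathbb{T}^d)$. The (small) Hankel operator $\mathbf{H}_\varphi$ from $H^2(\mathbb{T}^d)$ to $\overline{H^2}(\mathbb{T}^d)$ is $\mathbf{H}_\varphi f = \overline{P}(\overline{\varphi} f)$ (here $\varphi$ is a polynomial, so this is a bounded operator). In the decomposition in (a), $\mathbf{0}$ acts on $\bigoplus_{k\geq m+1}H^2_k(\mathbb{T}^d)$.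 In (b), operators $A\colon X_1\to Y_1$ and $B\colon X_2\to Y_2$ between Hilbert spaces are unitarily equivalent if $VA=BU$ for some unitary maps $U\colon X_1\to X_2$ and $V\colon Y_1\to Y_2$; also, $\mathbf{H}_{\varphi,k}$ is regarded as an operator from $H^2_k(\mathbb{T}^d)$ to $\overline{H^2_{m-k}}(\mathbb{T}^d)$, and $\overline{z}=(\overline{z_1},\ldots,\overline{z_d})$. *)

theory Defs
  imports "HOL-Probability.Probability"
begin

text \<open>The dimension is \<open>d = CARD('d)\<close>; a point of the torus is a function \<open>z :: 'd \<Rightarrow> complex\<close>
  all of whose values are unimodular. The normalized Haar measure is the product of the
  normalized arc length measures.\<close>

definition circle :: "complex measure" where
  "circle = distr (restrict_space lborel {0..1}) (restrict_space borel (sphere 0 1))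
     (\<lambda>t. cis (2 * pi * t))"

definition torus :: "('d::finite \<Rightarrow> complex) measure" where
  "torus = (\<Pi>\<^sub>M j\<in>UNIV. circle)"

lemma measurable_cis_circle:
  "(\<lambda>t. cis (2 * pi * t)) \<in> measurable (restrict_space lborel {0..1}) (restrict_space borel (sphere 0 1))"
proof -
  have "(\<lambda>t. cis (2 * pi * t)) \<in> borel_measurable lborel"
    by (simp add: measurable_lborel1 borel_measurable_continuous_onI continuous_intros)
  then have "(\<lambda>t. cis (2 * pi * t)) \<in> measurable lborel (restrict_space borel (sphere 0 1))"
    by (intro measurable_restrict_space2) auto
  then show ?thesis
    by (rule measurable_restrict_space1)
qed

lemma prob_space_circle: "prob_space circle"
proof -
  have "emeasure (restrict_space lborel {0..1::real}) {0..1} = 1"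
    by (subst emeasure_restrict_space) auto
  then have "prob_space (restrict_space lborel {0..1::real})"
    by (intro prob_spaceI) (simp add: space_restrict_space)
  then show ?thesis
    unfolding circle_def by (rule prob_space.prob_space_distr) (rule measurable_cis_circle)
qed

lemma sets_circle [measurable_cong]: "sets circle = sets (restrict_space borel (sphere 0 1))"
  by (simp add: circle_def)

lemma prob_space_torus: "prob_space (torus :: ('d::finite \<Rightarrow> complex) measure)"
  unfolding torus_def by (intro prob_space_PiM prob_space_circle)

lemma measurable_cnj_circle: "cnj \<in> measurable circle circle"
proof -
  have "cnj \<in> borel_measurable (borel :: complex measure)"
    by (intro borel_measurable_continuous_onI continuous_intros)
  then have "cnj \<in> borel_measurable (restrict_space borel (sphere 0 1))"
    by (rule measurable_restrict_space1)
  then have "cnj \<in> measurable (restrict_space borel (sphere 0 1)) (restrict_space borel (sphere 0 1))"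
    by (intro measurable_restrict_space2) (auto simp: space_restrict_space)
  then show ?thesis
    by (simp add: measurable_cong_sets[OF sets_circle sets_circle])
qed

lemma distr_reflect:
  "distr (restrict_space lborel {0..1}) (restrict_space lborel {0..1}) (\<lambda>t. 1 - t)
     = restrict_space lborel {0..1::real}" (is "distr ?R ?R ?f = ?R")
proof (rule measure_eqI)
  fix A assume "A \<in> sets (distr ?R ?R ?f)"
  then have A: "A \<in> sets ?R" by simp
  then have Ab: "A \<in> sets borel" "A \<subseteq> {0..1}"
    by (auto simp: sets_restrict_space)
  have f: "?f \<in> measurable ?R ?R"
    by (intro measurable_restrict_space2 measurable_restrict_space1) (auto simp: space_restrict_space)
  have eq: "?f -` A \<inter> {0..1} = ?f -` A"
    using Ab by auto
  have d: "distr lborel borel ?f = (lborel :: real measure)"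
    using lborel_real_affine[of "-1" 1] by (simp add: density_1 one_ereal_def[symmetric])
  have "emeasure (distr ?R ?R ?f) A = emeasure ?R (?f -` A)"
    using A f by (simp add: emeasure_distr space_restrict_space eq)
  also have "\<dots> = emeasure lborel (?f -` A)"
    using Ab by (subst emeasure_restrict_space) auto
  also have "\<dots> = emeasure (distr lborel borel ?f) A"
    using Ab by (subst emeasure_distr) auto
  also have "\<dots> = emeasure ?R A"
    unfolding d using Ab by (subst emeasure_restrict_space) auto
  finally show "emeasure (distr ?R ?R ?f) A = emeasure ?R A" .
qed simp

lemma distr_cnj_circle: "distr circle circle cnj = circle"
proof -
  let ?R = "restrict_space lborel {0..1::real}"
  let ?S = "restrict_space borel (sphere 0 1) :: complex measure"
  let ?c = "\<lambda>t. cis (2 * pi * t)"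
  have f: "(\<lambda>t. 1 - t) \<in> measurable ?R ?R"
    by (intro measurable_restrict_space2 measurable_restrict_space1) (auto simp: space_restrict_space)
  have c: "cnj \<in> measurable ?S ?S"
    using measurable_cnj_circle by (simp add: measurable_cong_sets[OF sets_circle sets_circle])
  have "distr circle circle cnj = distr circle ?S cnj"
    by (intro distr_cong) (auto simp: sets_circle)
  also have "\<dots> = distr ?R ?S (cnj \<circ> ?c)"
    unfolding circle_def by (intro distr_distr c measurable_cis_circle)
  also have "cnj \<circ> ?c = ?c \<circ> (\<lambda>t. 1 - t)"
    by (simp add: fun_eq_iff complex_eq_iff right_diff_distrib cos_diff sin_diff)
  also have "distr ?R ?S (?c \<circ> (\<lambda>t. 1 - t)) = distr (distr ?R ?R (\<lambda>t. 1 - t)) ?S ?c"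
    by (intro distr_distr[symmetric] f measurable_cis_circle)
  also have "\<dots> = circle"
    by (simp add: distr_reflect circle_def)
  finally show ?thesis .
qed

lemma measurable_component_torus: "(\<lambda>z. z j) \<in> measurable torus circle"
  unfolding torus_def by (rule measurable_component_singleton) simp

lemma measurable_cnj_torus:
  "(\<lambda>z j. cnj (z j)) \<in> measurable torus (torus :: ('d::finite \<Rightarrow> complex) measure)"
proof -
  have "(\<lambda>z. cnj (z j)) \<in> measurable torus circle" for j :: 'd
    using measurable_component_torus measurable_cnj_circle by (rule measurable_compose)
  then have "(\<lambda>z. \<lambda>j\<in>UNIV. cnj (z j)) \<in> measurable torus (\<Pi>\<^sub>M j\<in>(UNIV :: 'd set). circle)"
    by (intro measurable_restrict)
  then show ?thesis
    by (simp add: torus_def restrict_UNIV)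
qed

lemma distr_cnj_torus:
  "distr torus torus (\<lambda>z j. cnj (z j)) = (torus :: ('d::finite \<Rightarrow> complex) measure)"
proof -
  have eq: "compose UNIV cnj = (\<lambda>z j. cnj (z j :: complex) :: complex)"
    by (simp add: compose_def fun_eq_iff)
  have "distr (Pi\<^sub>M UNIV (\<lambda>_::'d. circle)) (Pi\<^sub>M UNIV (\<lambda>_::'d. circle)) (compose UNIV cnj)
        = Pi\<^sub>M UNIV (\<lambda>_. distr circle circle cnj)"
    by (intro distr_PiM_finite_prob_space')
       (auto intro: prob_space_circle measurable_cnj_circle)
  then show ?thesis
    unfolding torus_def distr_cnj_circle eq .
qed

definition square_integrable :: "(('d::finite \<Rightarrow> complex) \<Rightarrow> complex) \<Rightarrow> bool" where
  "square_integrable f \<longleftrightarrow>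
     f \<in> borel_measurable torus \<and> integrable torus (\<lambda>z. (cmod (f z))\<^sup>2)"

definition L2_rel ::
  "(('d::finite \<Rightarrow> complex) \<Rightarrow> complex) \<Rightarrow> (('d \<Rightarrow> complex) \<Rightarrow> complex) \<Rightarrow> bool" where
  "L2_rel f g \<longleftrightarrow>
     square_integrable f \<and> square_integrable g \<and> (AE z in torus. f z = g z)"

lemma square_integrable_zero: "square_integrable (\<lambda>_. 0)"
  by (simp add: square_integrable_def)

lemma square_integrable_add:
  assumes "square_integrable f" "square_integrable g"
  shows "square_integrable (\<lambda>z. f z + g z)"
proof -
  have m: "f \<in> borel_measurable torus" "g \<in> borel_measurable torus"
    and i: "integrable torus (\<lambda>z. 2 * (cmod (f z))\<^sup>2 + 2 * (cmod (g z))\<^sup>2)"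
    using assms by (auto simp: square_integrable_def)
  have "(cmod (a + b))\<^sup>2 \<le> 2 * (cmod a)\<^sup>2 + 2 * (cmod b)\<^sup>2" for a b
  proof -
    have "(cmod (a + b))\<^sup>2 \<le> (cmod a + cmod b)\<^sup>2"
      by (intro power_mono norm_triangle_ineq) auto
    also have "\<dots> \<le> 2 * (cmod a)\<^sup>2 + 2 * (cmod b)\<^sup>2"
      using sum_squares_bound[of "cmod a" "cmod b"] by (simp add: power2_sum)
    finally show ?thesis .
  qed
  then have "integrable torus (\<lambda>z. (cmod (f z + g z))\<^sup>2)"
    using m by (intro Bochner_Integration.integrable_bound[OF i]) auto
  then show ?thesis
    using m by (simp add: square_integrable_def)
qed

lemma square_integrable_scale:
  assumes "square_integrable f"
  shows "square_integrable (\<lambda>z. c * f z)"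
  using assms by (auto simp: square_integrable_def norm_mult power_mult_distrib)

lemma borel_measurable_cnj: "cnj \<in> borel_measurable borel"
  by (intro borel_measurable_continuous_onI continuous_intros)

lemma square_integrable_cnj:
  assumes "square_integrable f"
  shows "square_integrable (\<lambda>z. cnj (f z))"
  using assms measurable_compose[OF _ borel_measurable_cnj, of f]
  by (simp add: square_integrable_def)

lemma square_integrable_reflect:
  fixes f :: "('d::finite \<Rightarrow> complex) \<Rightarrow> complex"
  assumes "square_integrable f"
  shows "square_integrable (\<lambda>z. f (\<lambda>j. cnj (z j)))"
proof -
  have m: "f \<in> borel_measurable torus" and i: "integrable torus (\<lambda>z. (cmod (f z))\<^sup>2)"
    using assms by (auto simp: square_integrable_def)
  have "integrable (distr torus torus (\<lambda>z j. cnj (z j))) (\<lambda>z. (cmod (f z))\<^sup>2)"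
    using i by (simp add: distr_cnj_torus)
  then have "integrable torus (\<lambda>z. (cmod (f (\<lambda>j. cnj (z j))))\<^sup>2)"
    by (rule integrable_distr[OF measurable_cnj_torus])
  then show ?thesis
    using measurable_compose[OF measurable_cnj_torus m] by (simp add: square_integrable_def)
qed

lemma square_integrable_prod_cnj:
  assumes "square_integrable f" "square_integrable g"
  shows "integrable torus (\<lambda>z. f z * cnj (g z))"
proof -
  have m: "f \<in> borel_measurable torus" "(\<lambda>z. cnj (g z)) \<in> borel_measurable torus"
    and i: "integrable torus (\<lambda>z. (cmod (f z))\<^sup>2 + (cmod (g z))\<^sup>2)"
    using assms square_integrable_cnj[OF assms(2)] by (auto simp: square_integrable_def)
  have "cmod a * cmod b \<le> (cmod a)\<^sup>2 + (cmod b)\<^sup>2" for a b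
  proof -
    have "0 \<le> cmod a * cmod b" by simp
    then show ?thesis using sum_squares_bound[of "cmod a" "cmod b"] by linarith
  qed
  then show ?thesis
    using m by (intro Bochner_Integration.integrable_bound[OF i]) (auto simp: norm_mult)
qed

lemma part_equivp_L2_rel: "part_equivp (L2_rel :: (('d::finite \<Rightarrow> complex) \<Rightarrow> complex) \<Rightarrow> _)"
proof (rule part_equivpI)
  show "\<exists>f::('d \<Rightarrow> complex) \<Rightarrow> complex. L2_rel f f"
    by (rule exI[of _ "\<lambda>_. 0"]) (simp add: L2_rel_def square_integrable_zero)
  show "symp (L2_rel :: (('d \<Rightarrow> complex) \<Rightarrow> complex) \<Rightarrow> _)"
    by (rule sympI) (auto simp: L2_rel_def elim: eventually_mono)
  show "transp (L2_rel :: (('d \<Rightarrow> complex) \<Rightarrow> complex) \<Rightarrow> _)"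
    by (rule transpI) (auto simp: L2_rel_def elim: eventually_elim2)
qed

quotient_type 'd L2 = "('d::finite \<Rightarrow> complex) \<Rightarrow> complex" / partial: "L2_rel"
  by (rule part_equivp_L2_rel)

lift_definition l2_inner :: "'d::finite L2 \<Rightarrow> 'd L2 \<Rightarrow> complex"
  is "\<lambda>f g. integral\<^sup>L torus (\<lambda>z. f z * cnj (g z))"
proof -
  fix f f' g g' :: "('d \<Rightarrow> complex) \<Rightarrow> complex"
  assume a: "L2_rel f f'" "L2_rel g g'"
  then have "AE z in torus. f z * cnj (g z) = f' z * cnj (g' z)"
    by (auto simp: L2_rel_def elim: eventually_elim2)
  with a show "integral\<^sup>L torus (\<lambda>z. f z * cnj (g z)) = integral\<^sup>L torus (\<lambda>z. f' z * cnj (g' z))"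
    by (intro integral_cong_AE borel_measurable_integrable square_integrable_prod_cnj)
       (auto simp: L2_rel_def)
qed

lift_definition l2_scale :: "complex \<Rightarrow> 'd::finite L2 \<Rightarrow> 'd L2" is "\<lambda>c f z. c * f z"
  by (auto simp: L2_rel_def square_integrable_scale)

lift_definition l2_cnj :: "'d::finite L2 \<Rightarrow> 'd L2" is "\<lambda>f z. cnj (f z)"
  by (auto simp: L2_rel_def square_integrable_cnj)

lift_definition l2_tilde :: "'d::finite L2 \<Rightarrow> 'd L2" is "\<lambda>f z. cnj (f (\<lambda>j. cnj (z j)))"
proof -
  fix f g :: "('d \<Rightarrow> complex) \<Rightarrow> complex"
  assume a: "L2_rel f g"
  then have "AE z in distr torus torus (\<lambda>z j. cnj (z j)). f z = g z"
    unfolding distr_cnj_torus by (simp add: L2_rel_def)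
  then have "AE z in torus. f (\<lambda>j. cnj (z j)) = g (\<lambda>j. cnj (z j))"
    by (rule AE_distrD[OF measurable_cnj_torus])
  with a show "L2_rel (\<lambda>z. cnj (f (\<lambda>j. cnj (z j)))) (\<lambda>z. cnj (g (\<lambda>j. cnj (z j))))"
    by (auto simp: L2_rel_def intro!: square_integrable_cnj square_integrable_reflect)
qed

text \<open>The pointwise product of two square integrable functions need not be square integrable;
  the value is then \<open>0\<close> by convention. The Hankel operator below is only considered for
  polynomial symbols, where one of the factors is bounded and the convention plays no role.\<close>

lift_definition l2_mult :: "'d::finite L2 \<Rightarrow> 'd L2 \<Rightarrow> 'd L2"
  is "\<lambda>f g. if square_integrable (\<lambda>z. f z * g z) then (\<lambda>z. f z * g z) else (\<lambda>_. 0)"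
proof -
  fix f f' g g' :: "('d \<Rightarrow> complex) \<Rightarrow> complex"
  assume a: "L2_rel f f'" "L2_rel g g'"
  then have eq: "AE z in torus. f z * g z = f' z * g' z"
    by (auto simp: L2_rel_def elim: eventually_elim2)
  have m: "(\<lambda>z. f z * g z) \<in> borel_measurable torus" "(\<lambda>z. f' z * g' z) \<in> borel_measurable torus"
    using a by (auto simp: L2_rel_def square_integrable_def)
  have "integrable torus (\<lambda>z. (cmod (f z * g z))\<^sup>2) \<longleftrightarrow> integrable torus (\<lambda>z. (cmod (f' z * g' z))\<^sup>2)"
    using m eq by (intro integrable_cong_AE) (auto elim: eventually_mono)
  with m have "square_integrable (\<lambda>z. f z * g z) \<longleftrightarrow> square_integrable (\<lambda>z. f' z * g' z)"
    by (simp add: square_integrable_def)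
  then show "L2_rel (if square_integrable (\<lambda>z. f z * g z) then (\<lambda>z. f z * g z) else (\<lambda>_. 0))
    (if square_integrable (\<lambda>z. f' z * g' z) then (\<lambda>z. f' z * g' z) else (\<lambda>_. 0))"
    using eq by (simp add: L2_rel_def square_integrable_zero)
qed

instantiation L2 :: (finite) real_vector
begin

lift_definition zero_L2 :: "'a L2" is "\<lambda>_. 0"
  by (simp add: L2_rel_def square_integrable_zero)

lift_definition plus_L2 :: "'a L2 \<Rightarrow> 'a L2 \<Rightarrow> 'a L2" is "\<lambda>f g z. f z + g z"
  by (auto simp: L2_rel_def intro: square_integrable_add elim: eventually_elim2)

lift_definition uminus_L2 :: "'a L2 \<Rightarrow> 'a L2" is "\<lambda>f z. - f z"
  using square_integrable_scale[of _ "-1"] by (auto simp: L2_rel_def)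

definition minus_L2 :: "'a L2 \<Rightarrow> 'a L2 \<Rightarrow> 'a L2" where "minus_L2 f g = f + (- g)"

definition scaleR_L2 :: "real \<Rightarrow> 'a L2 \<Rightarrow> 'a L2" where "scaleR_L2 r f = l2_scale (of_real r) f"

instance
proof
  fix f g h :: "'a L2" and r s :: real
  show "f + g + h = f + (g + h)"
    by transfer (auto simp: L2_rel_def add.assoc intro!: square_integrable_add)
  show "f + g = g + f"
    by transfer (auto simp: L2_rel_def add.commute intro!: square_integrable_add)
  show "0 + f = f"
    by transfer (auto simp: L2_rel_def)
  show "- f + f = 0"
    by transfer (auto simp: L2_rel_def square_integrable_zero)
  show "f - g = f + - g"
    by (rule minus_L2_def)
  show "r *\<^sub>R (f + g) = r *\<^sub>R f + r *\<^sub>R g"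
    unfolding scaleR_L2_def
    by transfer (auto simp: L2_rel_def ring_distribs intro!: square_integrable_add square_integrable_scale)
  show "(r + s) *\<^sub>R f = r *\<^sub>R f + s *\<^sub>R f"
    unfolding scaleR_L2_def
    by transfer (auto simp: L2_rel_def ring_distribs intro!: square_integrable_add square_integrable_scale)
  show "r *\<^sub>R s *\<^sub>R f = (r * s) *\<^sub>R f"
    unfolding scaleR_L2_def
    by transfer (auto simp: L2_rel_def mult.assoc intro!: square_integrable_scale)
  show "1 *\<^sub>R f = f"
    unfolding scaleR_L2_def by transfer (auto simp: L2_rel_def)
qed

end

lemma l2_inner_commute: "l2_inner f g = cnj (l2_inner g f)"
proof transfer
  fix f g :: "('a \<Rightarrow> complex) \<Rightarrow> complex"
  have "cnj (integral\<^sup>L torus (\<lambda>z. g z * cnj (f z))) = integral\<^sup>L torus (\<lambda>z. cnj (g z * cnj (f z)))"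
    by (rule Bochner_Integration.integral_cnj[symmetric])
  then show "integral\<^sup>L torus (\<lambda>z. f z * cnj (g z)) = cnj (integral\<^sup>L torus (\<lambda>z. g z * cnj (f z)))"
    by (simp add: mult.commute)
qed

lemma l2_inner_add_left: "l2_inner (f + g) h = l2_inner f h + l2_inner g h"
  by transfer (simp add: L2_rel_def ring_distribs square_integrable_prod_cnj)

lemma l2_inner_scale_left: "l2_inner (l2_scale c f) g = c * l2_inner f g"
  by transfer (simp add: mult.assoc)

lemma l2_inner_self: "0 \<le> Re (l2_inner f f)" "Re (l2_inner f f) = 0 \<longleftrightarrow> f = 0"
proof -
  have eq: "integral\<^sup>L torus (\<lambda>z. f z * cnj (f z)) = of_real (integral\<^sup>L torus (\<lambda>z. (cmod (f z))\<^sup>2))"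
    for f :: "('a \<Rightarrow> complex) \<Rightarrow> complex"
    by (simp only: complex_norm_square[symmetric] integral_complex_of_real)
  show "0 \<le> Re (l2_inner f f)"
    by transfer (simp add: eq)
  show "Re (l2_inner f f) = 0 \<longleftrightarrow> f = 0"
  proof transfer
    fix f :: "('a \<Rightarrow> complex) \<Rightarrow> complex"
    assume a: "L2_rel f f"
    then have "integral\<^sup>L torus (\<lambda>z. (cmod (f z))\<^sup>2) = 0 \<longleftrightarrow> (AE z in torus. (cmod (f z))\<^sup>2 = 0)"
      by (intro integral_nonneg_eq_0_iff_AE) (auto simp: L2_rel_def square_integrable_def)
    with a show "Re (integral\<^sup>L torus (\<lambda>z. f z * cnj (f z))) = 0 \<longleftrightarrow> L2_rel f (\<lambda>_. 0)"
      by (simp add: eq L2_rel_def square_integrable_zero)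
  qed
qed

instantiation L2 :: (finite) real_inner
begin

definition inner_L2 :: "'a L2 \<Rightarrow> 'a L2 \<Rightarrow> real" where "inner_L2 f g = Re (l2_inner f g)"

definition norm_L2 :: "'a L2 \<Rightarrow> real" where "norm_L2 f = sqrt (Re (l2_inner f f))"

definition sgn_L2 :: "'a L2 \<Rightarrow> 'a L2" where "sgn_L2 f = f /\<^sub>R norm f"

definition dist_L2 :: "'a L2 \<Rightarrow> 'a L2 \<Rightarrow> real" where "dist_L2 f g = norm (f - g)"

definition uniformity_L2 :: "('a L2 \<times> 'a L2) filter" where
  "uniformity_L2 = (INF e\<in>{0 <..}. principal {(f, g). dist f g < e})"

definition open_L2 :: "'a L2 set \<Rightarrow> bool" where
  "open_L2 S \<longleftrightarrow> (\<forall>f\<in>S. \<forall>\<^sub>F (f', g) in uniformity. f' = f \<longrightarrow> g \<in> S)"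

instance
proof
  fix f g h :: "'a L2" and r :: real
  show "inner f g = inner g f"
    using l2_inner_commute[of f g] by (simp add: inner_L2_def)
  show "inner (f + g) h = inner f h + inner g h"
    by (simp add: inner_L2_def l2_inner_add_left)
  show "inner (r *\<^sub>R f) g = r * inner f g"
    by (simp add: inner_L2_def scaleR_L2_def l2_inner_scale_left)
  show "0 \<le> inner f f" "(inner f f = 0) = (f = 0)"
    by (simp_all add: inner_L2_def l2_inner_self)
  show "norm f = sqrt (inner f f)"
    by (simp add: norm_L2_def inner_L2_def)
qed (simp_all add: sgn_L2_def dist_L2_def uniformity_L2_def open_L2_def)

end

lift_definition fourier_coeff :: "'d::finite L2 \<Rightarrow> ('d \<Rightarrow> int) \<Rightarrow> complex"
  is "\<lambda>f \<alpha>. integral\<^sup>L torus (\<lambda>z. f z * cnj (\<Prod>j\<in>UNIV. z j powi \<alpha> j))"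
proof -
  fix f g :: "('d \<Rightarrow> complex) \<Rightarrow> complex"
  assume a: "L2_rel f g"
  let ?e = "\<lambda>(\<alpha> :: 'd \<Rightarrow> int) z. cnj (\<Prod>j\<in>UNIV. z j powi \<alpha> j)"
  have c: "(\<lambda>z. z j) \<in> borel_measurable torus" for j :: 'd
    using measurable_component_torus[of j]
    by (simp add: measurable_cong_sets[OF refl sets_circle] measurable_restrict_space2_iff)
  have "(\<lambda>z. z j powi n) \<in> borel_measurable torus" for j :: 'd and n
    using c[of j] by (auto simp: power_int_def)
  then have "(\<lambda>z. \<Prod>j\<in>UNIV. z j powi \<alpha> j) \<in> borel_measurable torus" for \<alpha> :: "'d \<Rightarrow> int"
    by (intro borel_measurable_prod)
  then have e: "?e \<alpha> \<in> borel_measurable torus" for \<alpha>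
    by (rule measurable_compose[OF _ borel_measurable_cnj])
  have "integral\<^sup>L torus (\<lambda>z. f z * ?e \<alpha> z) = integral\<^sup>L torus (\<lambda>z. g z * ?e \<alpha> z)" for \<alpha>
    using a e by (intro integral_cong_AE) (auto simp: L2_rel_def square_integrable_def elim: eventually_mono)
  then show "(\<lambda>\<alpha>. integral\<^sup>L torus (\<lambda>z. f z * ?e \<alpha> z)) = (\<lambda>\<alpha>. integral\<^sup>L torus (\<lambda>z. g z * ?e \<alpha> z))"
    by (rule ext)
qed

definition H2 :: "'d::finite L2 set" where
  "H2 = {f. \<forall>\<alpha>. fourier_coeff f \<alpha> \<noteq> 0 \<longrightarrow> (\<forall>j. 0 \<le> \<alpha> j)}"

definition homogeneous :: "nat \<Rightarrow> 'd::finite L2 \<Rightarrow> bool" where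
  "homogeneous m f \<longleftrightarrow> (\<forall>\<alpha>. fourier_coeff f \<alpha> \<noteq> 0 \<longrightarrow> (\<Sum>j\<in>UNIV. \<alpha> j) = int m)"

definition H2_hom :: "nat \<Rightarrow> 'd::finite L2 set" where
  "H2_hom m = {f \<in> H2. homogeneous m f}"

definition H2_conj :: "'d::finite L2 set" where
  "H2_conj = l2_cnj ` H2"

definition H2_conj_hom :: "nat \<Rightarrow> 'd::finite L2 set" where
  "H2_conj_hom m = l2_cnj ` H2_hom m"

definition orth_proj :: "'d::finite L2 set \<Rightarrow> 'd L2 \<Rightarrow> 'd L2" where
  "orth_proj S f = (THE g. g \<in> S \<and> (\<forall>h\<in>S. l2_inner (f - g) h = 0))"

definition adjoint_on ::
  "'d::finite L2 set \<Rightarrow> 'd L2 set \<Rightarrow> ('d L2 \<Rightarrow> 'd L2) \<Rightarrow> 'd L2 \<Rightarrow> 'd L2" where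
  "adjoint_on X Y T =
     (\<lambda>g\<in>Y. THE f. f \<in> X \<and> (\<forall>h\<in>X. l2_inner (T h) g = l2_inner h f))"

definition clinear_on :: "'d::finite L2 set \<Rightarrow> ('d L2 \<Rightarrow> 'd L2) \<Rightarrow> bool" where
  "clinear_on X T \<longleftrightarrow>
     (\<forall>f\<in>X. \<forall>g\<in>X. T (f + g) = T f + T g) \<and> (\<forall>c. \<forall>f\<in>X. T (l2_scale c f) = l2_scale c (T f))"

definition unitary_on :: "'d::finite L2 set \<Rightarrow> 'd L2 set \<Rightarrow> ('d L2 \<Rightarrow> 'd L2) \<Rightarrow> bool" where
  "unitary_on X Y U \<longleftrightarrow>
     clinear_on X U \<and> U ` X = Y \<and> (\<forall>f\<in>X. \<forall>g\<in>X. l2_inner (U f) (U g) = l2_inner f g)"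

definition unitarily_equivalent ::
  "'d::finite L2 set \<Rightarrow> 'd L2 set \<Rightarrow> ('d L2 \<Rightarrow> 'd L2) \<Rightarrow>
   'd L2 set \<Rightarrow> 'd L2 set \<Rightarrow> ('d L2 \<Rightarrow> 'd L2) \<Rightarrow> bool" where
  "unitarily_equivalent X1 Y1 A X2 Y2 B \<longleftrightarrow>
     (\<exists>U V. unitary_on X1 X2 U \<and> unitary_on Y1 Y2 V \<and> (\<forall>f\<in>X1. V (A f) = B (U f)))"

definition orthogonal_family :: "'i set \<Rightarrow> ('i \<Rightarrow> 'd::finite L2 set) \<Rightarrow> bool" where
  "orthogonal_family I X \<longleftrightarrow>
     (\<forall>i\<in>I. \<forall>j\<in>I. i \<noteq> j \<longrightarrow> (\<forall>f\<in>X i. \<forall>g\<in>X j. l2_inner f g = 0))"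

text \<open>The Hilbert space direct sum of a family of mutually orthogonal subspaces: all sums, convergent
  in norm, of vectors chosen from the summands.\<close>

definition hilbert_sum :: "'i set \<Rightarrow> ('i \<Rightarrow> 'd::finite L2 set) \<Rightarrow> 'd L2 set" where
  "hilbert_sum I X = {f. \<exists>g. (\<forall>i\<in>I. g i \<in> X i) \<and> (g has_sum f) I}"

text \<open>\<open>T : X \<rightarrow> Y\<close> is the orthogonal direct sum of the operators \<open>S i : A i \<rightarrow> B i\<close>:
  both \<open>X\<close> and \<open>Y\<close> split orthogonally, and \<open>T\<close> acts blockwise.\<close>

definition orthogonal_decomposition ::
  "'d::finite L2 set \<Rightarrow> 'd L2 set \<Rightarrow> ('d L2 \<Rightarrow> 'd L2) \<Rightarrow> 'i set \<Rightarrow>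
   ('i \<Rightarrow> 'd L2 set) \<Rightarrow> ('i \<Rightarrow> 'd L2 set) \<Rightarrow> ('i \<Rightarrow> 'd L2 \<Rightarrow> 'd L2) \<Rightarrow> bool" where
  "orthogonal_decomposition X Y T I A B S \<longleftrightarrow>
     orthogonal_family I A \<and> X = hilbert_sum I A \<and>
     orthogonal_family I B \<and> Y = hilbert_sum I B \<and>
     (\<forall>i\<in>I. S i ` A i \<subseteq> B i) \<and>
     (\<forall>g f. (\<forall>i\<in>I. g i \<in> A i) \<and> (g has_sum f) I \<longrightarrow> ((\<lambda>i. S i (g i)) has_sum T f) I)"

definition hankel :: "'d::finite L2 \<Rightarrow> 'd L2 \<Rightarrow> 'd L2" where
  "hankel \<phi> = (\<lambda>f\<in>H2. orth_proj H2_conj (l2_mult (l2_cnj \<phi>) f))"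

definition hankel_hom :: "'d::finite L2 \<Rightarrow> nat \<Rightarrow> 'd L2 \<Rightarrow> 'd L2" where
  "hankel_hom \<phi> k = restrict (hankel \<phi>) (H2_hom k)"

end

theory Submission
  imports Defs
begin

text \<open>The monomials form an orthonormal basis of \<open>L\<^sup>2\<close> of the torus: by Stone-Weierstrass their closed
  span contains the continuous functions, hence the indicators of closed sets, hence by Dynkin's
  lemma all indicators. Moreover, all the spaces involved consist of the functions
  whose Fourier coefficients are supported on a prescribed set of frequencies. The operator
  \<open>H\<^sub>\<phi>\<close> with \<open>m\<close>-homogeneous symbol lowers the total degree by \<open>m\<close>, so it maps degree \<open>k\<close> to
  degree \<open>k - m\<close> and annihilates degrees above \<open>m\<close>. For the adjoint, let \<open>R f(z)\<close> be \<open>f\<close> evaluated at the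
  conjugate of \<open>z\<close>; this unitary involution exchanges \<open>H\<^sup>2\<close> and its conjugate. Since \<open>R\<close> is
  multiplicative and maps \<open>\<phi>\<close> to the conjugate of \<open>\<phi>\<close>-tilde, the adjoint of \<open>H\<^sub>\<phi>\<close> is \<open>R H R\<close>, where \<open>H\<close> has
  symbol \<open>\<phi>\<close>-tilde.\<close>

subsection \<open>Orthonormality of the monomials\<close>

text \<open>\<open>'d L2\<close> is only available as a real inner product space; its completeness
  is never established. Projections and adjoints are definite descriptions, so their values have to
  be exhibited. This is possible because only finitely many multi-indices with nonnegative entries
  have sum \<open>m\<close>: the symbol is a trigonometric polynomial, and for \<open>f\<close> in
  \<open>H2\<close> all frequencies of \<open>hankel \<phi> f\<close> have entries between -m and 0.
  The working formula is that the coefficient of \<open>hankel \<phi> f\<close> at \<beta> is the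
  sum over \<alpha> of cnj (coefficient of \<phi> at \<alpha>) times (coefficient of f at \<alpha> +
  \<beta>) if all entries of \<beta> are at most 0, and 0 otherwise. Density of the trigonometric
  polynomials is needed because it makes Fourier coefficients determine an element, so that
  identities and orthogonality can be checked frequency by frequency. A second obstacle is that
  \<open>l2_mult\<close> has a default value and hence is not additive in general. Products are
  therefore evaluated by moving a bounded factor to the other side of the inner product.\<close>

lemma space_circle: "space circle = sphere 0 1"
  by (simp add: circle_def space_restrict_space)

lemma space_torus: "space torus = {z. \<forall>j::'d::finite. cmod (z j) = 1}"
  by (auto simp: torus_def space_PiM space_circle PiE_def Pi_def)

lemma borel_measurable_coordinate [measurable]: "(\<lambda>z. z j) \<in> borel_measurable torus"
  using measurable_component_torus[of j]
  by (simp add: measurable_cong_sets[OF refl sets_circle] measurable_restrict_space2_iff)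

lemma finite_measure_torus: "finite_measure (torus :: ('d::finite \<Rightarrow> complex) measure)"
  using prob_space_torus by (rule prob_space.finite_measure)

lemma square_integrable_bounded:
  assumes m: "f \<in> borel_measurable torus" and b: "\<And>z. z \<in> space torus \<Longrightarrow> cmod (f z) \<le> B"
  shows "square_integrable f"
proof -
  interpret finite_measure "torus :: ('a \<Rightarrow> complex) measure" by (rule finite_measure_torus)
  have "integrable torus (\<lambda>z. (cmod (f z))\<^sup>2)"
    using m b by (intro integrable_const_bound[where B = "B\<^sup>2"] AE_I2) (auto intro: power_mono)
  then show ?thesis using m by (simp add: square_integrable_def)
qed

definition monomial :: "('d::finite \<Rightarrow> int) \<Rightarrow> ('d \<Rightarrow> complex) \<Rightarrow> complex" where
  "monomial \<alpha> z = (\<Prod>j\<in>UNIV. z j powi \<alpha> j)"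

lemma borel_measurable_monomial [measurable]: "monomial \<alpha> \<in> borel_measurable torus"
proof -
  have "(\<lambda>z. z j powi n) \<in> borel_measurable torus" for j :: 'a and n
    by (auto simp: power_int_def)
  then show ?thesis
    unfolding monomial_def[abs_def] by (intro borel_measurable_prod)
qed

lemma cmod_monomial: "z \<in> space torus \<Longrightarrow> cmod (monomial \<alpha> z) = 1"
  by (simp add: monomial_def prod_norm[symmetric] norm_power_int space_torus)

lemma square_integrable_monomial: "square_integrable (monomial \<alpha>)"
  by (rule square_integrable_bounded[where B = 1]) (auto simp: cmod_monomial)

lemma monomial_zero: "monomial (\<lambda>_. 0) z = 1"
  by (simp add: monomial_def)

lemma unimodular_nonzero: "z \<in> space torus \<Longrightarrow> z j \<noteq> 0"
  by (metis (mono_tags, lifting) mem_Collect_eq norm_zero space_torus zero_neq_one)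

lemma monomial_add: "z \<in> space torus \<Longrightarrow> monomial (\<lambda>j. \<alpha> j + \<beta> j) z = monomial \<alpha> z * monomial \<beta> z"
  by (simp add: monomial_def power_int_add unimodular_nonzero prod.distrib)

lemma cnj_unimodular: "cmod w = 1 \<Longrightarrow> cnj w = inverse w"
  by (metis complex_div_cnj div_by_1 inverse_eq_divide mult_1 of_real_1 one_power2)

lemma cnj_power_int: "cnj (w powi n) = cnj w powi n"
  by (simp add: power_int_def)

lemma cnj_monomial: "z \<in> space torus \<Longrightarrow> cnj (monomial \<alpha> z) = monomial (\<lambda>j. - \<alpha> j) z"
  by (simp add: monomial_def cnj_power_int space_torus cnj_unimodular power_int_minus power_int_inverse)

lemma borel_measurable_power_int: "(\<lambda>w. w powi n) \<in> borel_measurable (borel :: complex measure)"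
  by (cases "n \<ge> 0") (simp_all add: power_int_def)

text \<open>For nonzero \<open>n\<close> the antiderivative of cis (2 pi n t) takes the same value
  at 0 and at 1.\<close>

lemma integral_circle_power_int:
  "integral\<^sup>L circle (\<lambda>w. w powi n) = (if n = 0 then 1 else 0)"
proof -
  have m: "(\<lambda>w::complex. w powi n) \<in> borel_measurable (restrict_space borel (sphere 0 1))"
    by (rule measurable_restrict_space1, rule borel_measurable_power_int)
  have "integral\<^sup>L circle (\<lambda>w. w powi n)
      = integral\<^sup>L (restrict_space lborel {0..1}) (\<lambda>t. cis (2 * pi * t) powi n)"
    unfolding circle_def by (rule integral_distr[OF measurable_cis_circle m])
  also have "\<dots> = (\<integral>t. indicator {0..1} t *\<^sub>R cis (2 * pi * n * t) \<partial>lborel)"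
    by (subst integral_restrict_space) (auto simp: cis_power_int mult_ac)
  also have "\<dots> = (if n = 0 then 1 else 0)"
  proof (cases "n = 0")
    case True
    then show ?thesis by simp
  next
    case False
    let ?a = "2 * pi * n"
    have "((\<lambda>w. exp (\<i> * ?a * w) / (\<i> * ?a)) has_field_derivative exp (\<i> * ?a * of_real t)) (at (of_real t))" for t
      using False by (auto intro!: derivative_eq_intros)
    from has_vector_derivative_real_field[OF this]
    have *: "((\<lambda>t. cis (?a * t) / (\<i> * ?a)) has_vector_derivative cis (?a * t)) (at t within {0..1})" for t
      by (simp add: cis_conv_exp mult.assoc)
    have "(\<integral>t. indicator {0..1} t *\<^sub>R cis (?a * t) \<partial>lborel)
        = cis (?a * 1) / (\<i> * ?a) - cis (?a * 0) / (\<i> * ?a)"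
      by (rule integral_FTC_atLeastAtMost) (use * in \<open>auto intro!: continuous_intros\<close>)
    also have "cis (?a * 1) = 1"
      using cis_multiple_2pi[of "of_int n"] by simp
    finally show ?thesis using False by simp
  qed
  finally show ?thesis .
qed

text \<open>By Fubini the integral over the product measure factors into one integral over the
  circle per coordinate.\<close>

lemma integral_monomial:
  "integral\<^sup>L torus (monomial \<alpha>) = (if \<alpha> = (\<lambda>_. 0) then 1 else 0)"
proof -
  interpret c: prob_space circle by (rule prob_space_circle)
  interpret product_sigma_finite "\<lambda>_::'a. circle" by standard
  have "integrable circle (\<lambda>w. w powi n)" for n
  proof (rule c.integrable_const_bound[where B = 1])
    show "(\<lambda>w. w powi n) \<in> borel_measurable circle"
      unfolding measurable_cong_sets[OF sets_circle refl]
      by (rule measurable_restrict_space1, rule borel_measurable_power_int)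
  qed (auto simp: space_circle norm_power_int)
  then have "integral\<^sup>L torus (monomial \<alpha>) = (\<Prod>j\<in>UNIV. integral\<^sup>L circle (\<lambda>w. w powi \<alpha> j))"
    unfolding torus_def monomial_def[abs_def]
    by (intro product_integral_prod) auto
  also have "\<dots> = (if \<alpha> = (\<lambda>_. 0) then 1 else 0)"
    by (auto simp: integral_circle_power_int fun_eq_iff)
  finally show ?thesis .
qed

lift_definition l2_monomial :: "('d::finite \<Rightarrow> int) \<Rightarrow> 'd L2" is monomial
  by (simp add: L2_rel_def square_integrable_monomial)

lemma fourier_coeff_eq_inner: "fourier_coeff f \<alpha> = l2_inner f (l2_monomial \<alpha>)"
  by transfer (simp add: monomial_def)

lemma l2_inner_monomial:
  "l2_inner (l2_monomial \<alpha>) (l2_monomial \<beta>) = (if \<alpha> = \<beta> then 1 else 0)"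
proof transfer
  fix \<alpha> \<beta> :: "'a \<Rightarrow> int"
  have "integral\<^sup>L torus (\<lambda>z. monomial \<alpha> z * cnj (monomial \<beta> z))
      = integral\<^sup>L torus (monomial (\<lambda>j. \<alpha> j + - \<beta> j))"
    by (rule Bochner_Integration.integral_cong) (simp_all only: cnj_monomial monomial_add)
  also have "\<dots> = (if \<alpha> = \<beta> then 1 else 0)"
    by (auto simp: integral_monomial fun_eq_iff)
  finally show "integral\<^sup>L torus (\<lambda>z. monomial \<alpha> z * cnj (monomial \<beta> z)) = (if \<alpha> = \<beta> then 1 else 0)" .
qed

section \<open>Sesquilinear algebra and finite Fourier sums\<close>

lemma L2_rel_refl: "L2_rel f f \<longleftrightarrow> square_integrable f"
  by (auto simp: L2_rel_def)

lemma l2_scale_add_right: "l2_scale c (f + g) = l2_scale c f + l2_scale c g"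
  by transfer (auto simp: L2_rel_def ring_distribs intro!: square_integrable_add square_integrable_scale)

lemma l2_scale_l2_scale: "l2_scale c (l2_scale d f) = l2_scale (c * d) f"
  by transfer (auto simp: L2_rel_def mult_ac intro!: square_integrable_scale)

lemma uminus_eq_l2_scale: "- f = l2_scale (-1) (f :: 'd::finite L2)"
  by transfer (use square_integrable_scale[of _ "-1"] in \<open>auto simp: L2_rel_def\<close>)

lemma l2_inner_zero_left [simp]: "l2_inner 0 f = 0"
  by transfer simp

lemma l2_inner_minus_left: "l2_inner (- f) g = - l2_inner f g"
  by (simp add: uminus_eq_l2_scale l2_inner_scale_left)

lemma l2_inner_diff_left: "l2_inner (f - g) h = l2_inner f h - l2_inner g h"
  by (simp only: minus_L2_def l2_inner_add_left l2_inner_minus_left) simp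

lemma l2_inner_sum_left: "l2_inner (\<Sum>i\<in>I. f i) g = (\<Sum>i\<in>I. l2_inner (f i) g)"
  by (induction I rule: infinite_finite_induct) (auto simp: l2_inner_add_left)

lemma l2_inner_scale_right: "l2_inner f (l2_scale c g) = cnj c * l2_inner f g"
  unfolding l2_inner_commute[of f] by (simp add: l2_inner_scale_left)

lemma l2_inner_sum_right: "l2_inner g (\<Sum>i\<in>I. f i) = (\<Sum>i\<in>I. l2_inner g (f i))"
  unfolding l2_inner_commute[of g] by (simp add: l2_inner_sum_left)

lemma fourier_coeff_zero [simp]: "fourier_coeff 0 \<alpha> = 0"
  by (simp add: fourier_coeff_eq_inner)

lemma fourier_coeff_diff: "fourier_coeff (f - g) \<alpha> = fourier_coeff f \<alpha> - fourier_coeff g \<alpha>"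
  by (simp add: fourier_coeff_eq_inner l2_inner_diff_left)

lemma fourier_coeff_scale: "fourier_coeff (l2_scale c f) \<alpha> = c * fourier_coeff f \<alpha>"
  by (simp add: fourier_coeff_eq_inner l2_inner_scale_left)

lemma fourier_coeff_sum: "fourier_coeff (\<Sum>i\<in>I. f i) \<alpha> = (\<Sum>i\<in>I. fourier_coeff (f i) \<alpha>)"
  by (simp add: fourier_coeff_eq_inner l2_inner_sum_left)

text \<open>The coefficients are arbitrary, so that both general trigonometric polynomials and
  partial sums of a Fourier series have this form.\<close>

definition fourier_sum :: "(('d::finite \<Rightarrow> int) \<Rightarrow> complex) \<Rightarrow> ('d \<Rightarrow> int) set \<Rightarrow> 'd L2" where
  "fourier_sum c F = (\<Sum>\<alpha>\<in>F. l2_scale (c \<alpha>) (l2_monomial \<alpha>))"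

lemma fourier_coeff_fourier_sum:
  "finite F \<Longrightarrow> fourier_coeff (fourier_sum c F) \<alpha> = (if \<alpha> \<in> F then c \<alpha> else 0)"
  by (simp add: fourier_sum_def fourier_coeff_eq_inner l2_inner_sum_left l2_inner_scale_left
      l2_inner_monomial if_distrib cong: if_cong)

lemma l2_inner_fourier_sum_right:
  "l2_inner f (fourier_sum c F) = (\<Sum>\<alpha>\<in>F. cnj (c \<alpha>) * fourier_coeff f \<alpha>)"
  by (simp add: fourier_sum_def fourier_coeff_eq_inner l2_inner_sum_right l2_inner_scale_right)

lemma norm_l2_scale: "norm (l2_scale c f) = cmod c * norm f"
proof -
  have "Re (l2_inner (l2_scale c f) (l2_scale c f)) = Re (of_real ((cmod c)\<^sup>2) * l2_inner f f)"
    by (simp add: l2_inner_scale_left l2_inner_scale_right complex_norm_square mult_ac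
        del: of_real_power)
  then show ?thesis
    by (simp add: norm_L2_def real_sqrt_mult)
qed

text \<open>The inequality of the type class only controls the real part of \<open>l2_inner\<close>.
  Scaling \<open>f\<close> by the conjugate of the inner product makes that inner product real and
  nonnegative, and one factor \<open>cmod c\<close> cancels.\<close>

lemma cauchy_schwarz_l2_inner: "cmod (l2_inner f g) \<le> norm f * norm g"
proof -
  define c where "c = l2_inner f g"
  have "(cmod c)\<^sup>2 = Re (cnj c * c)"
    by (metis Re_complex_of_real complex_norm_square mult.commute)
  also have "\<dots> = inner (l2_scale (cnj c) f) g"
    by (simp add: inner_L2_def l2_inner_scale_left c_def)
  also have "\<dots> \<le> norm (l2_scale (cnj c) f) * norm g"
    by (rule norm_cauchy_schwarz)
  finally have "cmod c * cmod c \<le> cmod c * (norm f * norm g)"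
    by (simp only: power2_eq_square mult.assoc norm_l2_scale complex_mod_cnj)
  then have "cmod c \<le> norm f * norm g"
    by (cases "c = 0") auto
  then show ?thesis by (simp only: c_def)
qed

text \<open>Real linearity suffices for the purpose: it lets inner products, and in particular
  Fourier coefficients, be taken termwise in convergent sums.\<close>

lemma bounded_linear_l2_inner_left: "bounded_linear (\<lambda>f. l2_inner f g)"
  by (rule bounded_linear_intro[where K = "norm g"])
     (auto simp: l2_inner_add_left scaleR_L2_def l2_inner_scale_left scaleR_conv_of_real cauchy_schwarz_l2_inner)

lemma has_sum_fourier_coeff:
  assumes "(g has_sum f) I"
  shows "((\<lambda>i. fourier_coeff (g i) \<alpha>) has_sum fourier_coeff f \<alpha>) I"
  unfolding fourier_coeff_eq_inner
  using has_sum_bounded_linear[OF bounded_linear_l2_inner_left assms] by (simp add: o_def)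

subsection \<open>Density of trigonometric polynomials\<close>

lemma fourier_sum_add:
  assumes "finite F" "finite G"
  shows "fourier_sum c F + fourier_sum d G =
    fourier_sum (\<lambda>\<alpha>. (if \<alpha> \<in> F then c \<alpha> else 0) + (if \<alpha> \<in> G then d \<alpha> else 0)) (F \<union> G)"
proof -
  have add: "l2_scale (a + b) f = l2_scale a f + l2_scale b f" for a b and f :: "'a L2"
    by transfer (auto simp: L2_rel_def ring_distribs intro!: square_integrable_add square_integrable_scale)
  have zero: "l2_scale 0 f = 0" for f :: "'a L2"
    using norm_l2_scale[of 0 f] by simp
  have "fourier_sum e H = fourier_sum (\<lambda>\<alpha>. if \<alpha> \<in> H then e \<alpha> else 0) (F \<union> G)"
    if "H = F \<or> H = G" for e H
    unfolding fourier_sum_def using that assms by (intro sum.mono_neutral_cong_left) (auto simp: zero)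
  from this[of F c] this[of G d] show ?thesis
    by (simp add: fourier_sum_def add sum.distrib)
qed

lemma l2_scale_fourier_sum: "l2_scale a (fourier_sum c F) = fourier_sum (\<lambda>\<alpha>. a * c \<alpha>) F"
proof -
  have "l2_scale a 0 = 0"
    using norm_l2_scale[of a 0] by simp
  then have "l2_scale a (sum f F) = (\<Sum>\<alpha>\<in>F. l2_scale a (f \<alpha>))" for f :: "('a \<Rightarrow> int) \<Rightarrow> 'a L2"
    by (induction F rule: infinite_finite_induct) (auto simp: l2_scale_add_right)
  then show ?thesis
    by (simp add: fourier_sum_def l2_scale_l2_scale)
qed

definition trig_sums :: "'d::finite L2 set" where
  "trig_sums = {fourier_sum c F | c F. finite F}"

definition trig_closure :: "'d::finite L2 set" where
  "trig_closure = closure trig_sums"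

lemma trig_closure_sequential:
  "f \<in> trig_closure \<longleftrightarrow> (\<exists>x. (\<forall>n. x n \<in> trig_sums) \<and> x \<longlonglongrightarrow> f)"
  by (simp add: trig_closure_def closure_sequential)

lemma trig_sums_add:
  assumes "p \<in> trig_sums" "q \<in> trig_sums"
  shows "p + q \<in> trig_sums"
proof -
  obtain c F where p: "p = fourier_sum c F" "finite F"
    using assms(1) by (auto simp: trig_sums_def)
  obtain d G where q: "q = fourier_sum d G" "finite G"
    using assms(2) by (auto simp: trig_sums_def)
  have "finite (F \<union> G)" using p q by simp
  with fourier_sum_add[OF p(2) q(2), of c d] show ?thesis
    unfolding p(1) q(1) trig_sums_def by blast
qed

lemma trig_sums_scale: "p \<in> trig_sums \<Longrightarrow> l2_scale a p \<in> trig_sums"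
  unfolding trig_sums_def using l2_scale_fourier_sum by blast

lemma trig_closure_add:
  assumes "f \<in> trig_closure" "g \<in> trig_closure"
  shows "f + g \<in> trig_closure"
proof -
  obtain x where x: "\<And>n. x n \<in> trig_sums" "x \<longlonglongrightarrow> f"
    using assms(1) unfolding trig_closure_sequential by auto
  obtain y where y: "\<And>n. y n \<in> trig_sums" "y \<longlonglongrightarrow> g"
    using assms(2) unfolding trig_closure_sequential by auto
  have "x n + y n \<in> trig_sums" for n
    using x(1) y(1) by (rule trig_sums_add)
  then show ?thesis
    using tendsto_add[OF x(2) y(2)] unfolding trig_closure_sequential
    by (intro exI[of _ "\<lambda>n. x n + y n"]) simp
qed

lemma trig_closure_scale:
  assumes "f \<in> trig_closure"
  shows "l2_scale a f \<in> trig_closure"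
proof -
  \<comment> \<open>\<open>'a L2\<close> is an instance of \<open>real_vector\<close> only, so
    continuity of complex scaling is obtained from a real-linear map with bound
    \<open>cmod a\<close>.\<close>
  have bl: "bounded_linear (l2_scale a :: 'a L2 \<Rightarrow> 'a L2)"
    by (rule bounded_linear_intro[where K = "cmod a"])
       (auto simp: l2_scale_add_right scaleR_L2_def l2_scale_l2_scale norm_l2_scale mult_ac)
  obtain x where x: "\<And>n. x n \<in> trig_sums" "x \<longlonglongrightarrow> f"
    using assms unfolding trig_closure_sequential by auto
  have "l2_scale a (x n) \<in> trig_sums" for n
    using x(1) by (rule trig_sums_scale)
  then show ?thesis
    using bounded_linear.tendsto[OF bl x(2)] unfolding trig_closure_sequential
    by (intro exI[of _ "\<lambda>n. l2_scale a (x n)"]) simp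
qed

text \<open>Stated for functions rather than classes, since the approximation arguments use
  pointwise limits, uniform bounds and indicators.\<close>

definition trig_approximable :: "(('d::finite \<Rightarrow> complex) \<Rightarrow> complex) \<Rightarrow> bool" where
  "trig_approximable f \<longleftrightarrow> square_integrable f \<and> abs_L2 f \<in> trig_closure"

lemma trig_approximable_add:
  assumes "trig_approximable f" "trig_approximable g"
  shows "trig_approximable (\<lambda>z. f z + g z)"
proof -
  have "abs_L2 (\<lambda>z. f z + g z) = abs_L2 f + abs_L2 g"
    using assms by (simp add: trig_approximable_def plus_L2.abs_eq L2_rel_refl)
  then show ?thesis
    using assms by (simp add: trig_approximable_def square_integrable_add trig_closure_add)
qed

lemma trig_approximable_scale:
  assumes "trig_approximable f"
  shows "trig_approximable (\<lambda>z. c * f z)"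
proof -
  have "abs_L2 (\<lambda>z. c * f z) = l2_scale c (abs_L2 f)"
    using assms by (simp add: trig_approximable_def l2_scale.abs_eq L2_rel_refl)
  then show ?thesis
    using assms by (simp add: trig_approximable_def square_integrable_scale trig_closure_scale)
qed

text \<open>Functions are defined on all of \<open>'d \<Rightarrow> complex\<close>, but only their
  values on the torus matter. This allows a set to be replaced by its trace on the torus.\<close>

lemma trig_approximable_cong:
  assumes "\<And>z. z \<in> space torus \<Longrightarrow> f z = g z"
  shows "trig_approximable f \<longleftrightarrow> trig_approximable g"
proof -
  have m: "f \<in> borel_measurable torus \<longleftrightarrow> g \<in> borel_measurable torus"
    using assms by (rule measurable_cong)
  have i: "integrable torus (\<lambda>z. (cmod (f z))\<^sup>2) \<longleftrightarrow> integrable torus (\<lambda>z. (cmod (g z))\<^sup>2)"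
    using assms by (intro Bochner_Integration.integrable_cong) auto
  have s: "square_integrable f \<longleftrightarrow> square_integrable g"
    using m i by (simp add: square_integrable_def)
  have "abs_L2 f = abs_L2 g" if "square_integrable f"
  proof -
    have "L2_rel f g"
      using that s assms by (auto simp: L2_rel_def intro: AE_I2)
    then show ?thesis by (rule Quotient3_rel_abs[OF Quotient3_L2])
  qed
  with s show ?thesis by (auto simp: trig_approximable_def)
qed

lemma trig_approximable_monomial: "trig_approximable (monomial \<alpha>)"
proof -
  have "abs_L2 (monomial \<alpha>) = fourier_sum (\<lambda>_. 1) {\<alpha>}"
    by (simp add: fourier_sum_def l2_monomial.abs_eq l2_scale.abs_eq L2_rel_refl square_integrable_monomial)
  then show ?thesis
    unfolding trig_approximable_def trig_closure_def
    by (auto simp: square_integrable_monomial trig_sums_def intro!: closure_subset[THEN subsetD])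
qed

lemma trig_approximable_const: "trig_approximable (\<lambda>_. c)"
  using trig_approximable_scale[OF trig_approximable_monomial[of "\<lambda>_. 0"], of c]
  by (simp add: monomial_zero)

lemma trig_approximable_indicator_empty: "trig_approximable (indicator {})"
  using trig_approximable_const[of 0] by (subst trig_approximable_cong[of _ "\<lambda>_. 0"]) auto

lemma trig_approximable_sum:
  assumes "\<And>i. i \<in> I \<Longrightarrow> trig_approximable (f i)"
  shows "trig_approximable (\<lambda>z. \<Sum>i\<in>I. f i z)"
  using assms
  by (induction I rule: infinite_finite_induct) (auto intro: trig_approximable_const trig_approximable_add)

lemma norm_abs_L2:
  assumes "square_integrable f"
  shows "norm (abs_L2 f) = sqrt (\<integral>z. (cmod (f z))\<^sup>2 \<partial>torus)"
proof -
  have "l2_inner (abs_L2 f) (abs_L2 f) = (\<integral>z. f z * cnj (f z) \<partial>torus)"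
    using assms by (simp add: l2_inner.abs_eq L2_rel_refl)
  also have "\<dots> = of_real (\<integral>z. (cmod (f z))\<^sup>2 \<partial>torus)"
    by (simp only: complex_norm_square[symmetric] integral_complex_of_real)
  finally show ?thesis by (simp add: norm_L2_def)
qed

lemma abs_L2_diff:
  assumes "square_integrable f" "square_integrable g"
  shows "abs_L2 f - abs_L2 g = abs_L2 (\<lambda>z. f z - g z)"
proof -
  have "square_integrable (\<lambda>z. - g z)"
    using square_integrable_scale[OF assms(2), of "-1"] by simp
  then show ?thesis
    unfolding minus_L2_def using assms by (simp add: uminus_L2.abs_eq plus_L2.abs_eq L2_rel_refl)
qed

text \<open>Dominated convergence applied to the squared distance turns pointwise convergence under
  a square integrable majorant into norm convergence, and \<open>trig_closure\<close> is closed.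
  Each enlargement of the class of approximable functions below is an instance.\<close>

lemma trig_approximable_limit:
  assumes s: "\<And>n::nat. trig_approximable (s n)"
    and f: "f \<in> borel_measurable torus"
    and lim: "\<And>z. z \<in> space torus \<Longrightarrow> (\<lambda>n. s n z) \<longlonglongrightarrow> f z"
    and bound: "\<And>n z. z \<in> space torus \<Longrightarrow> cmod (s n z) \<le> w z"
    and w: "integrable torus (\<lambda>z. (w z)\<^sup>2)"
  shows "trig_approximable f"
proof -
  have sq: "square_integrable (s n)" and cl: "abs_L2 (s n) \<in> trig_closure" for n
    using s[of n] by (auto simp: trig_approximable_def)
  have m: "s n \<in> borel_measurable torus" for n
    using sq[of n] by (simp add: square_integrable_def)
  have fb: "cmod (f z) \<le> w z" if "z \<in> space torus" for z
    using bound[OF that] by (intro LIMSEQ_le_const2[OF tendsto_norm[OF lim[OF that]]]) auto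
  have "integrable torus (\<lambda>z. (cmod (f z))\<^sup>2)"
    using f fb by (intro Bochner_Integration.integrable_bound[OF w] AE_I2) (auto intro!: power_mono)
  with f have sf: "square_integrable f"
    by (simp add: square_integrable_def)
  have "(\<lambda>n. \<integral>z. (cmod (s n z - f z))\<^sup>2 \<partial>torus) \<longlonglongrightarrow> (\<integral>z. 0 \<partial>(torus :: ('a \<Rightarrow> complex) measure))"
  proof (rule integral_dominated_convergence[where w = "\<lambda>z. 4 * (w z)\<^sup>2"])
    show "integrable torus (\<lambda>z. 4 * (w z)\<^sup>2)"
      using w by simp
    show "(\<lambda>z. (cmod (s n z - f z))\<^sup>2) \<in> borel_measurable torus" for n
      using m f by simp
    show "AE z in torus. (\<lambda>n. (cmod (s n z - f z))\<^sup>2) \<longlonglongrightarrow> 0"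
    proof (rule AE_I2)
      fix z :: "'a \<Rightarrow> complex" assume "z \<in> space torus"
      from tendsto_power[OF tendsto_norm[OF tendsto_diff[OF lim[OF this] tendsto_const[of "f z"]]], of 2]
      show "(\<lambda>n. (cmod (s n z - f z))\<^sup>2) \<longlonglongrightarrow> 0" by simp
    qed
    show "AE z in torus. norm ((cmod (s n z - f z))\<^sup>2) \<le> 4 * (w z)\<^sup>2" for n
    proof (rule AE_I2)
      fix z :: "'a \<Rightarrow> complex" assume z: "z \<in> space torus"
      \<comment> \<open>The limit inherits the bound \<open>w\<close>, so the difference is at most
        \<open>2 * w z\<close>; this is the source of the factor 4 in the majorant.\<close>
      have "cmod (s n z - f z) \<le> 2 * w z"
        using norm_triangle_ineq4[of "s n z" "f z"] bound[OF z, of n] fb[OF z] by linarith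
      then have "(cmod (s n z - f z))\<^sup>2 \<le> (2 * w z)\<^sup>2"
        by (intro power_mono) auto
      then show "norm ((cmod (s n z - f z))\<^sup>2) \<le> 4 * (w z)\<^sup>2"
        by (simp add: power_mult_distrib)
    qed
  qed simp
  then have "(\<lambda>n. sqrt (\<integral>z. (cmod (s n z - f z))\<^sup>2 \<partial>torus)) \<longlonglongrightarrow> sqrt 0"
    by (intro tendsto_real_sqrt) simp
  moreover have "square_integrable (\<lambda>z. s n z - f z)" for n
    using square_integrable_add[OF sq[of n] square_integrable_scale[OF sf, of "-1"]] by simp
  ultimately have "(\<lambda>n. norm (abs_L2 (s n) - abs_L2 f)) \<longlonglongrightarrow> 0"
    by (simp add: abs_L2_diff sq sf norm_abs_L2)
  then have "(\<lambda>n. abs_L2 (s n)) \<longlonglongrightarrow> abs_L2 f"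
    by (subst Lim_null) (rule tendsto_norm_zero_cancel)
  moreover have "closed (trig_closure :: 'a L2 set)"
    by (simp add: trig_closure_def)
  ultimately show ?thesis
    using cl sf closed_sequentially[of trig_closure "\<lambda>n. abs_L2 (s n)"] by (auto simp: trig_approximable_def)
qed

text \<open>Trigonometric polynomials as actual functions, because uniform approximation is a
  statement about values and not about classes.\<close>

inductive trig_poly :: "(('d::finite \<Rightarrow> complex) \<Rightarrow> complex) \<Rightarrow> bool" where
  monomial: "trig_poly (\<lambda>z. c * monomial \<alpha> z)"
| add: "trig_poly p \<Longrightarrow> trig_poly q \<Longrightarrow> trig_poly (\<lambda>z. p z + q z)"

lemma trig_approximable_trig_poly: "trig_poly p \<Longrightarrow> trig_approximable p"
  by (induction rule: trig_poly.induct)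
     (auto intro: trig_approximable_add trig_approximable_scale trig_approximable_monomial)

text \<open>Multiplicativity of monomials in the exponent needs unimodular coordinates, so products of
  trigonometric polynomials are only again of this form on the torus.\<close>

lemma trig_poly_mult:
  assumes "trig_poly p" "trig_poly q"
  shows "\<exists>r. trig_poly r \<and> (\<forall>z\<in>space torus. r z = p z * q z)"
  using assms(1)
proof induction
  case (monomial c \<alpha>)
  show ?case using assms(2)
  proof induction
    case (monomial d \<beta>)
    show ?case
      by (rule exI[of _ "\<lambda>z. (c * d) * monomial (\<lambda>j. \<alpha> j + \<beta> j) z"])
         (simp add: trig_poly.monomial monomial_add)
  next
    case (add p q)
    then obtain r s where "trig_poly r" "trig_poly s"
      "\<forall>z\<in>space torus. r z = c * monomial \<alpha> z * p z" "\<forall>z\<in>space torus. s z = c * monomial \<alpha> z * q z"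
      by blast
    then show ?case
      by (intro exI[of _ "\<lambda>z. r z + s z"]) (simp add: trig_poly.add ring_distribs)
  qed
next
  case (add p p')
  then obtain r s where "trig_poly r" "trig_poly s"
    "\<forall>z\<in>space torus. r z = p z * q z" "\<forall>z\<in>space torus. s z = p' z * q z"
    by blast
  then show ?case
    by (intro exI[of _ "\<lambda>z. r z + s z"]) (simp add: trig_poly.add ring_distribs)
qed

lemma monomial_single: "monomial (\<lambda>i. if i = j then n else 0) z = z j powi n"
  by (simp add: monomial_def if_distrib cong: if_cong)

text \<open>Tychonoff: the topology of the function type is the product topology, and the torus is a
  product of circles.\<close>

lemma compact_space_torus: "compact (space torus :: ('d::finite \<Rightarrow> complex) set)"
proof -
  have "compactin (product_topology (\<lambda>_::'d. euclidean) UNIV) (\<Pi>\<^sub>E j\<in>UNIV. sphere (0::complex) 1)"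
    by (subst compactin_PiE) simp
  moreover have "(\<Pi>\<^sub>E j\<in>UNIV. sphere (0::complex) 1) = (space torus :: ('d \<Rightarrow> complex) set)"
    by (auto simp: space_torus PiE_def)
  ultimately show ?thesis
    by (simp add: euclidean_product_topology)
qed

text \<open>The sigma-algebra of \<open>torus\<close> is a product of sigma-algebras, whereas
  continuity gives measurability for the Borel sets of the product topology. The inclusion of the
  torus into the function space is Borel measurable because its coordinates are.\<close>

lemma continuous_imp_borel_measurable_torus:
  fixes f :: "('d::finite \<Rightarrow> complex) \<Rightarrow> 'b::topological_space"
  assumes "continuous_on UNIV f"
  shows "f \<in> borel_measurable torus"
proof (rule measurable_compose[OF _ borel_measurable_continuous_onI[OF assms]])
  show "(\<lambda>z::'d \<Rightarrow> complex. z) \<in> borel_measurable torus"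
    by (rule measurable_coordinatewise_then_product) simp
qed

lemma trig_approximable_continuous:
  fixes f :: "('d::finite \<Rightarrow> complex) \<Rightarrow> real"
  assumes cont: "continuous_on UNIV f" and bound: "\<And>z. \<bar>f z\<bar> \<le> 1"
  shows "trig_approximable (\<lambda>z. complex_of_real (f z))"
proof -
  \<comment> \<open>Stone-Weierstrass is applied in its real form, hence to the real functions that
    agree on the torus with a complex trigonometric polynomial.\<close>
  define R where "R = {g :: ('d \<Rightarrow> complex) \<Rightarrow> real. continuous_on (space torus) g \<and>
    (\<exists>p. trig_poly p \<and> (\<forall>z\<in>space torus. complex_of_real (g z) = p z))}"
  have coord: "continuous_on S (\<lambda>z::'d \<Rightarrow> complex. z j)" for S j
    by (rule continuous_on_subset[OF continuous_on_product_coordinates]) simp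
  interpret function_ring_on R "space torus"
  proof
    show "compact (space torus :: ('d \<Rightarrow> complex) set)" by (rule compact_space_torus)
    show "continuous_on (space torus) g" if "g \<in> R" for g
      using that by (simp add: R_def)
    fix g h assume "g \<in> R" "h \<in> R"
    then obtain p q where c: "continuous_on (space torus) g" "continuous_on (space torus) h"
      and p: "trig_poly p" "\<forall>z\<in>space torus. complex_of_real (g z) = p z"
      and q: "trig_poly q" "\<forall>z\<in>space torus. complex_of_real (h z) = q z"
      by (auto simp: R_def)
    show "(\<lambda>z. g z + h z) \<in> R"
      unfolding R_def using c p q trig_poly.add[OF p(1) q(1)]
      by (auto intro!: continuous_intros exI[of _ "\<lambda>z. p z + q z"])
    from trig_poly_mult[OF p(1) q(1)] obtain r
      where "trig_poly r" "\<forall>z\<in>space torus. r z = p z * q z" by blast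
    then show "(\<lambda>z. g z * h z) \<in> R"
      unfolding R_def using c p q by (auto intro!: continuous_intros exI[of _ r])
  next
    show "(\<lambda>_. c) \<in> R" for c
      unfolding R_def using trig_poly.monomial[of "of_real c" "\<lambda>_. 0"]
      by (auto simp: monomial_zero intro!: exI[of _ "\<lambda>_. of_real c"])
  next
    fix x y :: "'d \<Rightarrow> complex" assume "x \<noteq> y"
    then obtain j where j: "x j \<noteq> y j" by auto
    let ?e = "\<lambda>n i. if i = j then n else (0::int)"
    have z: "monomial (?e 1) z = z j" "monomial (?e (-1)) z = cnj (z j)" if "z \<in> space torus" for z
      using that by (simp_all add: monomial_single power_int_minus cnj_unimodular space_torus)
    \<comment> \<open>On the torus the conjugate of a coordinate is its inverse, hence a monomial.
      So real and imaginary parts of coordinates lie in \<open>R\<close>, and they separate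
      points.\<close>
    have "(\<lambda>z. Re (z j)) \<in> R"
    proof -
      have "trig_poly (\<lambda>z. (1/2) * monomial (?e 1) z + (1/2) * monomial (?e (-1)) z)"
        by (intro trig_poly.intros)
      moreover have "\<forall>z\<in>space torus. complex_of_real (Re (z j))
          = (1/2) * monomial (?e 1) z + (1/2) * monomial (?e (-1)) z"
        by (simp add: z complex_eq_iff)
      moreover have "continuous_on (space torus) (\<lambda>z. Re (z j))"
        by (intro continuous_intros coord)
      ultimately show ?thesis
        unfolding R_def by blast
    qed
    moreover have "(\<lambda>z. Im (z j)) \<in> R"
    proof -
      have "trig_poly (\<lambda>z. (-\<i>/2) * monomial (?e 1) z + (\<i>/2) * monomial (?e (-1)) z)"
        by (intro trig_poly.intros)
      moreover have "\<forall>z\<in>space torus. complex_of_real (Im (z j))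
          = (-\<i>/2) * monomial (?e 1) z + (\<i>/2) * monomial (?e (-1)) z"
        by (simp add: z complex_eq_iff)
      moreover have "continuous_on (space torus) (\<lambda>z. Im (z j))"
        by (intro continuous_intros coord)
      ultimately show ?thesis
        unfolding R_def by blast
    qed
    moreover have "Re (x j) \<noteq> Re (y j) \<or> Im (x j) \<noteq> Im (y j)"
      using j by (auto simp: complex_eq_iff)
    ultimately show "\<exists>f\<in>R. f x \<noteq> f y"
      by (elim disjE) (rule bexI; assumption)+
  qed
  have "\<forall>n. \<exists>p. trig_poly p \<and> (\<forall>z\<in>space torus. cmod (p z - of_real (f z)) < 1 / Suc n)"
  proof
    fix n
    have "\<exists>g\<in>R. \<forall>z\<in>space torus. \<bar>f z - g z\<bar> < 1 / Suc n"
      by (rule Stone_Weierstrass_basic[OF continuous_on_subset[OF cont subset_UNIV]]) simp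
    then obtain g where "g \<in> R" and g: "\<forall>z\<in>space torus. \<bar>f z - g z\<bar> < 1 / Suc n"
      by (elim bexE)
    then obtain p where p: "trig_poly p" "\<forall>z\<in>space torus. complex_of_real (g z) = p z"
      unfolding R_def by blast
    have "cmod (p z - of_real (f z)) < 1 / Suc n" if z: "z \<in> space torus" for z
    proof -
      have "p z - of_real (f z) = of_real (g z - f z)"
        using p(2) z by simp
      then have "cmod (p z - of_real (f z)) = \<bar>f z - g z\<bar>"
        by (simp only: norm_of_real abs_minus_commute)
      then show ?thesis using g z by simp
    qed
    with p(1) show "\<exists>p. trig_poly p \<and> (\<forall>z\<in>space torus. cmod (p z - of_real (f z)) < 1 / Suc n)"
      by blast
  qed
  from choice[OF this] obtain p
    where "\<forall>n. trig_poly (p n) \<and> (\<forall>z\<in>space torus. cmod (p n z - of_real (f z)) < 1 / Suc n)"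
    by (elim exE)
  then have p: "\<And>n. trig_poly (p n)"
    "\<And>n z. z \<in> space torus \<Longrightarrow> cmod (p n z - of_real (f z)) < 1 / Suc n"
    by blast+
  \<comment> \<open>The majorant 2 is the bound 1 on \<open>f\<close> plus the uniform error, which
    is at most 1.\<close>
  show ?thesis
  proof (rule trig_approximable_limit[where s = p and w = "\<lambda>_. 2"])
    show "trig_approximable (p n)" for n
      using p(1) by (rule trig_approximable_trig_poly)
    show "(\<lambda>z. complex_of_real (f z)) \<in> borel_measurable torus"
      by (intro continuous_imp_borel_measurable_torus continuous_on_of_real cont)
    fix z :: "'d \<Rightarrow> complex" assume z: "z \<in> space torus"
    have "(\<lambda>n. p n z - of_real (f z)) \<longlonglongrightarrow> 0"
    proof (rule Lim_null_comparison[OF always_eventually LIMSEQ_inverse_real_of_nat], rule allI)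
      show "cmod (p n z - of_real (f z)) \<le> inverse (real (Suc n))" for n
        using p(2)[OF z, of n] by (simp only: inverse_eq_divide less_imp_le)
    qed
    then show "(\<lambda>n. p n z) \<longlonglongrightarrow> of_real (f z)"
      by (simp only: Lim_null[symmetric])
    fix n
    have "cmod (p n z - of_real (f z)) \<le> 1"
      using p(2)[OF z, of n] by (rule less_imp_le[OF less_le_trans]) simp
    then show "cmod (p n z) \<le> 2"
      using norm_triangle_sub[of "p n z" "of_real (f z)"] bound[of z] by simp
  qed (simp add: finite_measure.integrable_const finite_measure_torus)
qed

lemma trig_approximable_indicator_closed:
  assumes "closed (A :: ('d::finite \<Rightarrow> complex) set)"
  shows "trig_approximable (indicator A)"
proof (cases "A = {}")
  \<comment> \<open>The distance to the empty set is 0 by convention, so the cutoffs used below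
    would converge to 1 instead of the indicator.\<close>
  case True
  then show ?thesis by (simp add: trig_approximable_indicator_empty)
next
  case False
  \<comment> \<open>Continuous cutoffs equal to 1 on \<open>A\<close> and vanishing at distance at
    least \<open>1 / n\<close> from \<open>A\<close>. Off the closed set \<open>A\<close> the
    distance is positive, so they are eventually 0.\<close>
  define g where "g n z = max 0 (1 - real n * infdist z A)" for n and z :: "'d \<Rightarrow> complex"
  show ?thesis
  proof (rule trig_approximable_limit[where s = "\<lambda>n z. of_real (g n z)" and w = "\<lambda>_. 1"])
    have g: "0 \<le> g n z" "g n z \<le> 1" for n z
      by (auto simp: g_def infdist_nonneg)
    have "continuous_on UNIV (g n)" for n
      unfolding g_def[abs_def] by (intro continuous_intros)
    then show "trig_approximable (\<lambda>z. complex_of_real (g n z))" for n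
      using g by (intro trig_approximable_continuous) auto
    have "(\<lambda>z::'d \<Rightarrow> complex. z) \<in> borel_measurable torus"
      by (rule continuous_imp_borel_measurable_torus) (rule continuous_on_id)
    from measurable_compose[OF this borel_measurable_indicator[of A borel]]
    show "indicator A \<in> borel_measurable torus"
      using assms by simp
    show "cmod (of_real (g n z)) \<le> 1" for n z
      using g[of n z] by simp
    fix z :: "'d \<Rightarrow> complex"
    show "(\<lambda>n. complex_of_real (g n z)) \<longlonglongrightarrow> indicator A z"
    proof (cases "z \<in> A")
      case True
      then have "g n z = 1" for n by (simp add: g_def)
      with True show ?thesis by simp
    next
      case z: False
      then have "infdist z A > 0"
        using assms False by (intro infdist_pos_not_in_closed)
      then obtain N where N: "1 < real N * infdist z A"
        using reals_Archimedean3 by blast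
      have "g n z = 0" if "n \<ge> N" for n
      proof -
        have "real N * infdist z A \<le> real n * infdist z A"
          using that by (intro mult_right_mono) (auto simp: infdist_nonneg)
        with N show ?thesis by (simp add: g_def)
      qed
      then have "(\<lambda>n. complex_of_real (g n z)) \<longlonglongrightarrow> 0"
        by (intro tendsto_eventually eventually_sequentiallyI[of N]) simp
      with z show ?thesis by simp
    qed
  qed (simp add: finite_measure.integrable_const finite_measure_torus)
qed

text \<open>Closed sets are stable under intersection and generate the Borel sets. Complements act
  affinely on indicators, and a disjoint union is the limit of finite sums of indicators dominated
  by 1, which is square integrable as the measure is finite.\<close>

lemma trig_approximable_indicator_borel:
  assumes "A \<in> sets (borel :: ('d::finite \<Rightarrow> complex) measure)"
  shows "trig_approximable (indicator A)"
proof -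
  have id: "(\<lambda>z::'d \<Rightarrow> complex. z) \<in> borel_measurable torus"
    by (rule continuous_imp_borel_measurable_torus) (rule continuous_on_id)
  have "Int_stable (Collect closed)" "Collect closed \<subseteq> Pow UNIV"
    "A \<in> sigma_sets UNIV (Collect closed)"
    using assms by (auto simp: Int_stable_def borel_eq_closed)
  then show ?thesis
  proof (induct A rule: sigma_sets_induct_disjoint)
    case (basic A)
    then show ?case by (simp add: trig_approximable_indicator_closed)
  next
    case empty
    show ?case by (rule trig_approximable_indicator_empty)
  next
    case (compl A)
    have "indicator (UNIV - A) z = 1 + (-1) * (indicator A z :: complex)" for z
      by (simp add: indicator_def)
    then have eq: "indicator (UNIV - A) = (\<lambda>z. 1 + (-1) * (indicator A z :: complex))"
      by (rule ext)
    show ?case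
      unfolding eq
      by (intro trig_approximable_add trig_approximable_scale compl trig_approximable_const)
  next
    case (union D)
    show ?case
    proof (rule trig_approximable_limit[where s = "\<lambda>n. indicator (\<Union>i<n. D i)" and w = "\<lambda>_. 1"])
      fix n :: nat
      have "indicator (\<Union>i<n. D i) z = (\<Sum>i<n. indicator (D i) z :: complex)" for z
        using union(1) by (intro indicator_UN_disjoint) (auto simp: disjoint_family_on_def)
      then have eq: "indicator (\<Union>i<n. D i) = (\<lambda>z. \<Sum>i<n. indicator (D i) z :: complex)"
        by (rule ext)
      show "trig_approximable (indicator (\<Union>i<n. D i))"
        unfolding eq by (intro trig_approximable_sum union)
    next
      have "D i \<in> sets borel" for i
        using union(2) by (auto simp: borel_eq_closed)
      then have "(\<Union>i. D i) \<in> sets borel"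
        by auto
      from measurable_compose[OF id borel_measurable_indicator[OF this]]
      show "indicator (\<Union>i. D i) \<in> borel_measurable torus" .
      show "(\<lambda>n. indicator (\<Union>i<n. D i) z) \<longlonglongrightarrow> (indicator (\<Union>i. D i) z :: complex)" for z
        by (rule LIMSEQ_indicator_UN)
      show "cmod (indicator (\<Union>i<n. D i) z) \<le> 1" for n z
        by (simp split: split_indicator)
    qed (simp add: finite_measure.integrable_const finite_measure_torus)
  qed
qed

text \<open>Links the product sigma-algebra to the Borel sets of the ambient function space:
  coordinates are continuous, so the generating cylinders are traces of Borel sets.\<close>

lemma sets_torus_borel:
  assumes "A \<in> sets (torus :: ('d::finite \<Rightarrow> complex) measure)"
  shows "\<exists>B\<in>sets borel. A = B \<inter> space torus"
proof -
  let ?N = "restrict_space borel (space torus) :: ('d \<Rightarrow> complex) measure"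
  have "sets (\<Pi>\<^sub>M j\<in>(UNIV :: 'd set). circle) \<subseteq> sets ?N"
  proof (rule sets_PiM_in_sets)
    show "space ?N = (\<Pi>\<^sub>E j\<in>UNIV. space circle)"
      by (auto simp: space_restrict_space space_torus space_circle PiE_def)
    fix j :: 'd and A assume "A \<in> sets circle"
    then have "A \<in> sets borel"
      by (auto simp: sets_circle sets_restrict_space)
    then have "(\<lambda>z::'d \<Rightarrow> complex. z j) -` A \<inter> space borel \<in> sets borel"
      by (intro measurable_sets[of _ borel borel] borel_measurable_continuous_onI) auto
    moreover have "{z \<in> space ?N. z j \<in> A} = space torus \<inter> ((\<lambda>z. z j) -` A \<inter> space borel)"
      by (auto simp: space_restrict_space)
    ultimately show "{z \<in> space ?N. z j \<in> A} \<in> sets ?N"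
      by (auto simp: sets_restrict_space)
  qed
  with assms show ?thesis
    by (auto simp: torus_def sets_restrict_space)
qed

lemma finite_image_indicator_representation:
  fixes f :: "'a \<Rightarrow> complex"
  assumes "finite (f ` S)" "x \<in> S"
  shows "f x = (\<Sum>y\<in>f ` S. y * indicator (f -` {y} \<inter> S) x)"
proof -
  have "y * indicator (f -` {y} \<inter> S) x = (if y = f x then y else 0)" for y
    using assms(2) by simp
  moreover have "(\<Sum>y\<in>f ` S. if y = f x then y else 0) = f x"
    using assms by (subst sum.delta) simp_all
  ultimately show ?thesis by simp
qed

lemma trig_approximable_square_integrable:
  assumes "square_integrable f"
  shows "trig_approximable f"
proof -
  have f: "f \<in> borel_measurable torus" and i: "integrable torus (\<lambda>z. (cmod (f z))\<^sup>2)"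
    using assms by (auto simp: square_integrable_def)
  from borel_measurable_implies_sequence_metric[OF f, of 0] obtain s where
    s: "\<And>n. simple_function torus (s n)" and
    lim: "\<And>z. z \<in> space torus \<Longrightarrow> (\<lambda>n. s n z) \<longlonglongrightarrow> f z" and
    bound: "\<And>n z. z \<in> space torus \<Longrightarrow> cmod (s n z) \<le> 2 * cmod (f z)"
    by simp metis
  \<comment> \<open>The simple functions approximate \<open>f\<close> with distances to 0 at most
    doubled, which supplies the majorant \<open>2 * cmod (f z)\<close>.\<close>
  show ?thesis
  proof (rule trig_approximable_limit[where s = s and w = "\<lambda>z. 2 * cmod (f z)"])
    fix n
    have sets: "s n -` {y} \<inter> space torus \<in> sets torus" if "y \<in> s n ` space torus" for y
      using s[of n] that by (auto simp: simple_function_def)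
    have fin: "finite (s n ` space torus)"
      using s[of n] by (simp add: simple_function_def)
    have "trig_approximable (indicator (s n -` {y} \<inter> space torus))" if y: "y \<in> s n ` space torus" for y
    proof -
      obtain B where "B \<in> sets borel" "s n -` {y} \<inter> space torus = B \<inter> space torus"
        using sets_torus_borel[OF sets[OF y]] by blast
      then show ?thesis
        using trig_approximable_indicator_borel[of B]
        by (subst trig_approximable_cong[of _ "indicator B"]) (auto simp: indicator_def)
    qed
    then have "trig_approximable (\<lambda>z. \<Sum>y\<in>s n ` space torus. y * indicator (s n -` {y} \<inter> space torus) z)"
      by (intro trig_approximable_sum trig_approximable_scale)
    moreover have "s n z = (\<Sum>y\<in>s n ` space torus. y * indicator (s n -` {y} \<inter> space torus) z)"
      if "z \<in> space torus" for z
      using fin that by (rule finite_image_indicator_representation)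
    ultimately show "trig_approximable (s n)"
      by (rule iffD2[OF trig_approximable_cong, rotated])
  qed (use f lim bound i in \<open>auto simp: power_mult_distrib\<close>)
qed

lemma trig_closure_UNIV: "trig_closure = UNIV"
proof -
  have "f \<in> trig_closure" for f :: "'a L2"
  proof (induction f rule: L2.abs_induct)
    case (1 y)
    then show ?case
      using trig_approximable_square_integrable[of y]
      by (simp add: L2_rel_refl trig_approximable_def)
  qed
  then show ?thesis by blast
qed

text \<open>Best approximation: the error of the partial Fourier sum over \<open>G\<close> is
  orthogonal to every trigonometric polynomial with frequencies in \<open>G\<close>, so Pythagoras
  applies.\<close>

lemma norm_diff_fourier_sum_le:
  assumes "finite G" "F \<subseteq> G"
  shows "norm (f - fourier_sum (fourier_coeff f) G) \<le> norm (f - fourier_sum c F)"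
proof -
  let ?P = "fourier_sum (fourier_coeff f) G" and ?q = "fourier_sum c F"
  have fin: "finite F" using assms by (rule rev_finite_subset)
  have z: "fourier_coeff (f - ?P) \<alpha> = 0" if "\<alpha> \<in> G" for \<alpha>
    using that assms by (simp add: fourier_coeff_diff fourier_coeff_fourier_sum)
  have "l2_inner (f - ?P) ?P = 0" "l2_inner (f - ?P) ?q = 0"
    using z assms by (auto simp: l2_inner_fourier_sum_right intro!: sum.neutral)
  then have "inner (f - ?P) ?P = 0" "inner (f - ?P) ?q = 0"
    by (simp_all add: inner_L2_def)
  then have "inner (f - ?P) (?P - ?q) = 0"
    by (simp add: inner_diff_right)
  then have "(norm ((f - ?P) + (?P - ?q)))\<^sup>2 = (norm (f - ?P))\<^sup>2 + (norm (?P - ?q))\<^sup>2"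
    by (intro norm_add_Pythagorean) (simp add: orthogonal_def)
  then have "(norm (f - ?P))\<^sup>2 \<le> (norm (f - ?q))\<^sup>2"
    by simp
  then show ?thesis
    by (rule power2_le_imp_le) simp
qed

text \<open>Unordered summation requires the estimate for every finite \<open>G\<close> containing
  some fixed \<open>F\<close>. Density provides one good trigonometric polynomial, and with
  \<open>F\<close> its set of frequencies best approximation handles all larger \<open>G\<close> at
  once.\<close>

theorem has_sum_fourier_series:
  "((\<lambda>\<alpha>. l2_scale (fourier_coeff f \<alpha>) (l2_monomial \<alpha>)) has_sum f) UNIV"
  unfolding has_sum_def
proof (rule tendstoI)
  fix e :: real assume "0 < e"
  moreover have "f \<in> closure trig_sums"
    using trig_closure_UNIV by (auto simp: trig_closure_def)
  ultimately obtain p where "p \<in> trig_sums" "dist p f < e"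
    unfolding closure_approachable by blast
  then obtain c F where F: "finite F" "dist (fourier_sum c F) f < e"
    by (auto simp: trig_sums_def)
  have "dist (fourier_sum (fourier_coeff f) G) f < e" if "finite G" "F \<subseteq> G" for G
  proof -
    have "dist (fourier_sum (fourier_coeff f) G) f \<le> dist (fourier_sum c F) f"
      using norm_diff_fourier_sum_le[OF that, of f c] by (simp add: dist_norm norm_minus_commute)
    with F(2) show ?thesis by simp
  qed
  with F(1) show "\<forall>\<^sub>F G in finite_subsets_at_top UNIV.
      dist (\<Sum>\<alpha>\<in>G. l2_scale (fourier_coeff f \<alpha>) (l2_monomial \<alpha>)) f < e"
    unfolding eventually_finite_subsets_at_top fourier_sum_def[symmetric] by blast
qed

lemma fourier_coeff_inject:
  assumes "\<And>\<alpha>. fourier_coeff f \<alpha> = fourier_coeff g \<alpha>"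
  shows "f = g"
  using has_sum_fourier_series[of f] has_sum_fourier_series[of g] assms has_sum_unique by force

subsection \<open>Spaces of functions with prescribed spectrum\<close>

text \<open>Expanding \<open>f\<close> in its Fourier series writes the inner product as a sum of
  products of coefficients, each of which vanishes.\<close>

lemma l2_inner_eq_0:
  assumes "\<And>\<alpha>. fourier_coeff f \<alpha> = 0 \<or> fourier_coeff g \<alpha> = 0"
  shows "l2_inner f g = 0"
proof -
  have "((\<lambda>\<alpha>. l2_inner (l2_scale (fourier_coeff f \<alpha>) (l2_monomial \<alpha>)) g) has_sum l2_inner f g) UNIV"
    using has_sum_bounded_linear[OF bounded_linear_l2_inner_left has_sum_fourier_series, of f g]
    by (simp add: o_def)
  moreover have "l2_inner (l2_scale (fourier_coeff f \<alpha>) (l2_monomial \<alpha>)) g = 0" for \<alpha>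
    using assms[of \<alpha>]
    by (auto simp: l2_inner_scale_left l2_inner_commute[of "l2_monomial \<alpha>"] fourier_coeff_eq_inner)
  then have "((\<lambda>\<alpha>. l2_inner (l2_scale (fourier_coeff f \<alpha>) (l2_monomial \<alpha>)) g) has_sum 0) UNIV"
    by (rule has_sum_0)
  ultimately show ?thesis
    by (rule has_sum_unique)
qed

definition spectral_space :: "('d::finite \<Rightarrow> int) set \<Rightarrow> 'd L2 set" where
  "spectral_space N = {f. \<forall>\<alpha>. fourier_coeff f \<alpha> \<noteq> 0 \<longrightarrow> \<alpha> \<in> N}"

lemma spectral_spaceD: "f \<in> spectral_space N \<Longrightarrow> \<alpha> \<notin> N \<Longrightarrow> fourier_coeff f \<alpha> = 0"
  by (auto simp: spectral_space_def)

lemma spectral_space_mono: "N \<subseteq> N' \<Longrightarrow> spectral_space N \<subseteq> spectral_space N'"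
  by (auto simp: spectral_space_def)

lemma l2_monomial_spectral_space: "\<alpha> \<in> N \<Longrightarrow> l2_monomial \<alpha> \<in> spectral_space N"
  by (auto simp: spectral_space_def fourier_coeff_eq_inner l2_inner_monomial)

lemma fourier_sum_spectral_space: "finite F \<Longrightarrow> F \<subseteq> N \<Longrightarrow> fourier_sum c F \<in> spectral_space N"
  by (auto simp: spectral_space_def fourier_coeff_fourier_sum)

lemma fourier_sum_eq:
  assumes "f \<in> spectral_space N" "finite N"
  shows "fourier_sum (fourier_coeff f) N = f"
  using assms by (intro fourier_coeff_inject) (auto simp: fourier_coeff_fourier_sum spectral_spaceD)

lemma orthogonal_family_spectral_space:
  assumes "\<And>i j. i \<in> I \<Longrightarrow> j \<in> I \<Longrightarrow> i \<noteq> j \<Longrightarrow> N i \<inter> N j = {}"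
  shows "orthogonal_family I (\<lambda>i. spectral_space (N i))"
  unfolding orthogonal_family_def
proof (intro ballI impI)
  fix i j f g
  assume "i \<in> I" "j \<in> I" "i \<noteq> j" and fg: "f \<in> spectral_space (N i)" "g \<in> spectral_space (N j)"
  then have "\<alpha> \<notin> N i \<or> \<alpha> \<notin> N j" for \<alpha>
    using assms[of i j] by blast
  then show "l2_inner f g = 0"
    using fg by (intro l2_inner_eq_0) (blast dest: spectral_spaceD)
qed

lemma hilbert_sum_spectral_space_subset:
  "hilbert_sum I (\<lambda>i. spectral_space (N i)) \<subseteq> spectral_space (\<Union>i\<in>I. N i)"
proof
  fix f assume "f \<in> hilbert_sum I (\<lambda>i. spectral_space (N i))"
  then obtain g where g: "\<And>i. i \<in> I \<Longrightarrow> g i \<in> spectral_space (N i)" "(g has_sum f) I"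
    by (auto simp: hilbert_sum_def)
  have "fourier_coeff f \<alpha> = 0" if "\<alpha> \<notin> (\<Union>i\<in>I. N i)" for \<alpha>
  proof -
    have "((\<lambda>i. fourier_coeff (g i) \<alpha>) has_sum 0) I"
      using that g(1) by (intro has_sum_0) (auto dest: spectral_spaceD)
    then show ?thesis
      using has_sum_fourier_coeff[OF g(2)] has_sum_unique by blast
  qed
  then show "f \<in> spectral_space (\<Union>i\<in>I. N i)"
    by (auto simp: spectral_space_def)
qed

text \<open>The Fourier series is regrouped along the blocks. Finiteness of each \<open>N i\<close>
  makes every component a finite sum, so its existence does not rest on completeness.\<close>

lemma hilbert_sum_spectral_space:
  assumes fin: "\<And>i. i \<in> I \<Longrightarrow> finite (N i)"
    and disj: "\<And>i j. i \<in> I \<Longrightarrow> j \<in> I \<Longrightarrow> i \<noteq> j \<Longrightarrow> N i \<inter> N j = {}"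
  shows "hilbert_sum I (\<lambda>i. spectral_space (N i)) = spectral_space (\<Union>i\<in>I. N i)"
proof (rule antisym[OF hilbert_sum_spectral_space_subset subsetI])
  fix f assume f: "f \<in> spectral_space (\<Union>i\<in>I. N i)"
  let ?t = "\<lambda>\<alpha>. l2_scale (fourier_coeff f \<alpha>) (l2_monomial \<alpha>)"
  have "l2_scale 0 g = 0" for g :: "'b L2"
    using norm_l2_scale[of 0 g] by simp
  then have "(?t has_sum f) (\<Union>i\<in>I. N i) \<longleftrightarrow> (?t has_sum f) UNIV"
    using f by (intro has_sum_cong_neutral) (auto dest: spectral_spaceD)
  then have sum: "(?t has_sum f) (\<Union>i\<in>I. N i)"
    using has_sum_fourier_series by simp
  \<comment> \<open>Disjointness of the blocks lets the series over the union be indexed by pairs of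
    a block and a frequency in it.\<close>
  have "inj_on snd (Sigma I N)"
    using disj by (auto simp: inj_on_def)
  moreover have "snd ` Sigma I N = (\<Union>i\<in>I. N i)"
    by force
  ultimately have "((?t \<circ> snd) has_sum f) (Sigma I N)"
    using sum has_sum_reindex[of snd "Sigma I N" ?t f] by simp
  then have "((\<lambda>i. fourier_sum (fourier_coeff f) (N i)) has_sum f) I"
    by (rule has_sum_SigmaD) (simp add: fourier_sum_def fin has_sum_finiteI)
  then show "f \<in> hilbert_sum I (\<lambda>i. spectral_space (N i))"
    unfolding hilbert_sum_def using fin
    by (auto intro!: exI[of _ "\<lambda>i. fourier_sum (fourier_coeff f) (N i)"] fourier_sum_spectral_space)
qed

text \<open>Covers a splitting with one distinguished block \<open>k\<close>, later the tail of
  degrees above \<open>m\<close>. Its component is obtained by subtracting the finitely many others,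
  each of which is a finite Fourier sum.\<close>

lemma hilbert_sum_spectral_space_finite:
  assumes I: "finite I" "k \<in> I" and fin: "\<And>i. i \<in> I \<Longrightarrow> i \<noteq> k \<Longrightarrow> finite (N i)"
    and disj: "\<And>i j. i \<in> I \<Longrightarrow> j \<in> I \<Longrightarrow> i \<noteq> j \<Longrightarrow> N i \<inter> N j = {}"
  shows "hilbert_sum I (\<lambda>i. spectral_space (N i)) = spectral_space (\<Union>i\<in>I. N i)"
proof (rule antisym[OF hilbert_sum_spectral_space_subset subsetI])
  fix f assume f: "f \<in> spectral_space (\<Union>i\<in>I. N i)"
  define h where "h = (\<lambda>i. fourier_sum (fourier_coeff f) (N i))"
  define g where "g = (\<lambda>i. if i = k then f - (\<Sum>i\<in>I - {k}. h i) else h i)"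
  \<comment> \<open>Off \<open>N k\<close> the finite blocks already carry all coefficients of
    \<open>f\<close>, so the remainder has its spectrum in \<open>N k\<close>.\<close>
  have coeff: "fourier_coeff (\<Sum>i\<in>I - {k}. h i) \<alpha> = fourier_coeff f \<alpha>" if "\<alpha> \<notin> N k" for \<alpha>
  proof (cases "\<exists>i\<in>I. \<alpha> \<in> N i")
    case True
    then obtain i where i: "i \<in> I" "\<alpha> \<in> N i" by blast
    have "fourier_coeff (\<Sum>i\<in>I - {k}. h i) \<alpha> = (\<Sum>j\<in>I - {k}. if j = i then fourier_coeff f \<alpha> else 0)"
      unfolding fourier_coeff_sum h_def
      using i disj[of _ i] fin by (intro sum.cong) (auto simp: fourier_coeff_fourier_sum)
    then show ?thesis
      using I i that by auto
  next
    case False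
    then have "fourier_coeff f \<alpha> = 0" using f by (auto dest: spectral_spaceD)
    moreover have "fourier_coeff (h i) \<alpha> = 0" if "i \<in> I - {k}" for i
      using that False fin by (auto simp: h_def fourier_coeff_fourier_sum)
    ultimately show ?thesis by (simp add: fourier_coeff_sum)
  qed
  have "f = sum g I"
    using I by (simp add: sum.remove g_def)
  then have "(g has_sum f) I"
    using I by (intro has_sum_finiteI)
  moreover have "g i \<in> spectral_space (N i)" if "i \<in> I" for i
  proof (cases "i = k")
    case True
    then show ?thesis
      using coeff unfolding spectral_space_def by (simp add: g_def fourier_coeff_diff) metis
  next
    case False
    then show ?thesis using fin that by (simp add: g_def h_def fourier_sum_spectral_space)
  qed
  ultimately show "f \<in> hilbert_sum I (\<lambda>i. spectral_space (N i))"
    by (auto simp: hilbert_sum_def)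
qed

text \<open>Truncating the spectrum gives a residual with frequencies off \<open>N\<close>, hence
  orthogonal to the space. Testing against the monomials in \<open>N\<close> gives
  uniqueness.\<close>

lemma orth_proj_spectral_space:
  assumes fin: "finite {\<alpha> \<in> N. fourier_coeff f \<alpha> \<noteq> 0}"
  shows "orth_proj (spectral_space N) f = fourier_sum (fourier_coeff f) {\<alpha> \<in> N. fourier_coeff f \<alpha> \<noteq> 0}"
  unfolding orth_proj_def
proof (rule the_equality)
  let ?P = "fourier_sum (fourier_coeff f) {\<alpha> \<in> N. fourier_coeff f \<alpha> \<noteq> 0}"
  have P: "fourier_coeff ?P \<alpha> = (if \<alpha> \<in> N then fourier_coeff f \<alpha> else 0)" for \<alpha>
    by (simp add: fourier_coeff_fourier_sum[OF fin])
  have "l2_inner (f - ?P) h = 0" if "h \<in> spectral_space N" for h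
    using spectral_spaceD[OF that] by (intro l2_inner_eq_0) (auto simp: fourier_coeff_diff P)
  with fin show "?P \<in> spectral_space N \<and> (\<forall>h\<in>spectral_space N. l2_inner (f - ?P) h = 0)"
    by (auto intro: fourier_sum_spectral_space)
  fix g assume g: "g \<in> spectral_space N \<and> (\<forall>h\<in>spectral_space N. l2_inner (f - g) h = 0)"
  show "g = ?P"
  proof (rule fourier_coeff_inject)
    fix \<alpha>
    show "fourier_coeff g \<alpha> = fourier_coeff ?P \<alpha>"
    proof (cases "\<alpha> \<in> N")
      case True
      then have "fourier_coeff (f - g) \<alpha> = 0"
        using g by (simp add: fourier_coeff_eq_inner l2_monomial_spectral_space)
      with True show ?thesis by (simp add: P fourier_coeff_diff)
    next
      case False
      with g show ?thesis by (auto simp: P intro: spectral_spaceD)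
    qed
  qed
qed

section \<open>Conjugation and reflection of the variable\<close>

lemma l2_cnj_l2_cnj: "l2_cnj (l2_cnj f) = f"
  by transfer (simp add: L2_rel_refl)

lemma l2_inner_l2_cnj: "l2_inner (l2_cnj f) g = cnj (l2_inner f (l2_cnj g))"
  by transfer (simp flip: Bochner_Integration.integral_cnj)

lemma L2_rel_torusI:
  assumes "square_integrable f" "square_integrable g" "\<And>z. z \<in> space torus \<Longrightarrow> f z = g z"
  shows "L2_rel f g"
  using assms by (auto simp: L2_rel_def intro: AE_I2)

lemma l2_cnj_l2_monomial: "l2_cnj (l2_monomial \<alpha>) = l2_monomial (\<lambda>j. - \<alpha> j)"
  by transfer
     (auto intro!: L2_rel_torusI square_integrable_cnj square_integrable_monomial simp: cnj_monomial)

lemma fourier_coeff_l2_cnj: "fourier_coeff (l2_cnj f) \<alpha> = cnj (fourier_coeff f (\<lambda>j. - \<alpha> j))"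
  by (simp add: fourier_coeff_eq_inner l2_inner_l2_cnj l2_cnj_l2_monomial)

text \<open>The operator R of the overview. Both \<open>l2_tilde\<close> and \<open>l2_cnj\<close>
  are conjugate-linear, so the composite is linear; the two conjugations of the values cancel and
  only the one of the variable remains.\<close>

definition l2_reflect :: "'d::finite L2 \<Rightarrow> 'd L2" where
  "l2_reflect f = l2_cnj (l2_tilde f)"

lemma l2_cnj_l2_reflect: "l2_cnj (l2_reflect f) = l2_tilde f"
  by (simp add: l2_reflect_def l2_cnj_l2_cnj)

lemma l2_reflect_l2_reflect: "l2_reflect (l2_reflect f) = f"
  unfolding l2_reflect_def by transfer (simp add: L2_rel_refl)

lemma l2_reflect_add: "l2_reflect (f + g) = l2_reflect f + l2_reflect g"
  unfolding l2_reflect_def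
  by transfer (auto simp: L2_rel_refl intro!: square_integrable_add square_integrable_reflect)

lemma l2_reflect_scale: "l2_reflect (l2_scale c f) = l2_scale c (l2_reflect f)"
  unfolding l2_reflect_def
  by transfer (auto simp: L2_rel_refl intro!: square_integrable_scale square_integrable_reflect)

text \<open>Haar measure is invariant under conjugation of the coordinates.\<close>

lemma l2_inner_l2_reflect: "l2_inner (l2_reflect f) (l2_reflect g) = l2_inner f g"
  unfolding l2_reflect_def
proof transfer
  fix f g :: "('a \<Rightarrow> complex) \<Rightarrow> complex"
  let ?h = "\<lambda>z. f z * cnj (g z)"
  assume "L2_rel f f" "L2_rel g g"
  then have "?h \<in> borel_measurable torus"
    by (intro borel_measurable_integrable square_integrable_prod_cnj) (simp_all add: L2_rel_refl)
  then have "integral\<^sup>L (distr torus torus (\<lambda>z j. cnj (z j))) ?h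
      = (\<integral>z. ?h (\<lambda>j. cnj (z j)) \<partial>torus)"
    by (rule integral_distr[OF measurable_cnj_torus])
  then show "(\<integral>z. cnj (cnj (f (\<lambda>j. cnj (z j)))) * cnj (cnj (cnj (g (\<lambda>j. cnj (z j))))) \<partial>torus)
      = integral\<^sup>L torus ?h"
    by (simp add: distr_cnj_torus)
qed

lemma l2_reflect_l2_monomial: "l2_reflect (l2_monomial \<alpha>) = l2_monomial (\<lambda>j. - \<alpha> j)"
proof -
  have "monomial \<alpha> (\<lambda>j. cnj (z j)) = monomial (\<lambda>j. - \<alpha> j) z" if "z \<in> space torus" for z
    using cnj_monomial[OF that, of \<alpha>] by (simp add: monomial_def cnj_power_int)
  then show ?thesis
    unfolding l2_reflect_def
    by transfer (auto intro!: L2_rel_torusI square_integrable_reflect square_integrable_monomial)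
qed

lemma fourier_coeff_l2_reflect: "fourier_coeff (l2_reflect f) \<alpha> = fourier_coeff f (\<lambda>j. - \<alpha> j)"
  using l2_inner_l2_reflect[of f "l2_monomial (\<lambda>j. - \<alpha> j)"]
  by (simp add: fourier_coeff_eq_inner l2_reflect_l2_monomial)

lemma fourier_coeff_l2_tilde: "fourier_coeff (l2_tilde f) \<alpha> = cnj (fourier_coeff f \<alpha>)"
  by (simp add: fourier_coeff_l2_cnj fourier_coeff_l2_reflect flip: l2_cnj_l2_reflect)

lemma l2_mult_l2_reflect: "l2_mult (l2_reflect f) (l2_reflect g) = l2_reflect (l2_mult f g)"
  unfolding l2_reflect_def
proof transfer
  fix f g :: "('a \<Rightarrow> complex) \<Rightarrow> complex"
  let ?h = "\<lambda>z. f z * g z"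
  \<comment> \<open>Both sides take the same branch of the convention in
    \<open>l2_mult\<close>.\<close>
  have "square_integrable (\<lambda>z. ?h (\<lambda>j. cnj (z j))) \<longleftrightarrow> square_integrable ?h"
    using square_integrable_reflect[of ?h] square_integrable_reflect[of "\<lambda>z. ?h (\<lambda>j. cnj (z j))"]
    by auto
  then show "L2_rel
      (if square_integrable (\<lambda>z. cnj (cnj (f (\<lambda>j. cnj (z j)))) * cnj (cnj (g (\<lambda>j. cnj (z j)))))
       then (\<lambda>z. cnj (cnj (f (\<lambda>j. cnj (z j)))) * cnj (cnj (g (\<lambda>j. cnj (z j))))) else (\<lambda>_. 0))
      (\<lambda>z. cnj (cnj ((if square_integrable (\<lambda>z. f z * g z) then \<lambda>z. f z * g z else (\<lambda>_. 0)) (\<lambda>j. cnj (z j)))))"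
    by (auto simp: L2_rel_refl square_integrable_zero)
qed

subsection \<open>Multiplication by bounded symbols and the Hankel operator\<close>

text \<open>Symbols acting boundedly by multiplication: for these the convention in \<^const>\<open>l2_mult\<close> for
  products that are not square integrable never applies.\<close>

definition bounded_symbol :: "'d::finite L2 \<Rightarrow> bool" where
  "bounded_symbol \<phi> \<longleftrightarrow> (\<exists>p B. \<phi> = abs_L2 p \<and> p \<in> borel_measurable torus \<and>
     (\<forall>z\<in>space torus. cmod (p z) \<le> B))"

lemma bounded_symbolE:
  assumes "bounded_symbol \<phi>"
  obtains p where "\<phi> = abs_L2 p" "square_integrable p"
    "\<And>f. square_integrable f \<Longrightarrow> square_integrable (\<lambda>z. p z * f z)"
proof -
  from assms obtain p B where p: "\<phi> = abs_L2 p" "p \<in> borel_measurable torus"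
      and B: "\<And>z. z \<in> space torus \<Longrightarrow> cmod (p z) \<le> B"
    by (auto simp: bounded_symbol_def)
  have "square_integrable (\<lambda>z. p z * f z)" if f: "square_integrable f" for f
  proof -
    have m: "(\<lambda>z. p z * f z) \<in> borel_measurable torus" and i: "integrable torus (\<lambda>z. B\<^sup>2 * (cmod (f z))\<^sup>2)"
      using p f by (auto simp: square_integrable_def)
    have "(cmod (p z * f z))\<^sup>2 \<le> B\<^sup>2 * (cmod (f z))\<^sup>2" if "z \<in> space torus" for z
      using B[OF that] by (auto simp: norm_mult power_mult_distrib intro!: mult_right_mono power_mono)
    then have "integrable torus (\<lambda>z. (cmod (p z * f z))\<^sup>2)"
      using m by (intro Bochner_Integration.integrable_bound[OF i] AE_I2) auto
    with m show ?thesis by (simp add: square_integrable_def)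
  qed
  with p square_integrable_bounded[OF p(2) B] that show ?thesis by blast
qed

lemma bounded_symbol_l2_monomial: "bounded_symbol (l2_monomial \<alpha>)"
  unfolding bounded_symbol_def
  by (intro exI[of _ "monomial \<alpha>"] exI[of _ 1]) (simp add: l2_monomial.abs_eq cmod_monomial)

lemma bounded_symbol_l2_scale:
  assumes "bounded_symbol \<phi>"
  shows "bounded_symbol (l2_scale c \<phi>)"
proof -
  from assms obtain p B where p: "\<phi> = abs_L2 p" "p \<in> borel_measurable torus"
      and B: "\<And>z. z \<in> space torus \<Longrightarrow> cmod (p z) \<le> B"
    by (auto simp: bounded_symbol_def)
  have "l2_scale c \<phi> = abs_L2 (\<lambda>z. c * p z)"
    using square_integrable_bounded[OF p(2) B] by (simp add: p l2_scale.abs_eq L2_rel_refl)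
  moreover have "cmod (c * p z) \<le> cmod c * B" if "z \<in> space torus" for z
    using B[OF that] by (simp add: norm_mult mult_left_mono)
  ultimately show ?thesis
    unfolding bounded_symbol_def using p(2) by (intro exI[of _ "\<lambda>z. c * p z"] exI[of _ "cmod c * B"]) simp
qed

lemma bounded_symbol_add:
  assumes "bounded_symbol \<phi>" "bounded_symbol \<psi>"
  shows "bounded_symbol (\<phi> + \<psi>)"
proof -
  from assms(1) obtain p B where p: "\<phi> = abs_L2 p" "p \<in> borel_measurable torus"
      and B: "\<And>z. z \<in> space torus \<Longrightarrow> cmod (p z) \<le> B"
    by (auto simp: bounded_symbol_def)
  from assms(2) obtain q C where q: "\<psi> = abs_L2 q" "q \<in> borel_measurable torus"
      and C: "\<And>z. z \<in> space torus \<Longrightarrow> cmod (q z) \<le> C"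
    by (auto simp: bounded_symbol_def)
  have "\<phi> + \<psi> = abs_L2 (\<lambda>z. p z + q z)"
    using square_integrable_bounded[OF p(2) B] square_integrable_bounded[OF q(2) C]
    by (simp add: p q plus_L2.abs_eq L2_rel_refl)
  moreover have "cmod (p z + q z) \<le> B + C" if "z \<in> space torus" for z
    using B[OF that] C[OF that] norm_triangle_ineq[of "p z" "q z"] by linarith
  ultimately show ?thesis
    unfolding bounded_symbol_def using p(2) q(2)
    by (intro exI[of _ "\<lambda>z. p z + q z"] exI[of _ "B + C"]) simp
qed

lemma bounded_symbol_fourier_sum:
  assumes "finite F"
  shows "bounded_symbol (fourier_sum c F)"
proof -
  have "bounded_symbol 0"
    unfolding bounded_symbol_def by (intro exI[of _ "\<lambda>_. 0"] exI[of _ 0]) (simp add: zero_L2.abs_eq)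
  with assms show ?thesis
    unfolding fourier_sum_def
    by (induction F) (auto intro: bounded_symbol_add bounded_symbol_l2_scale bounded_symbol_l2_monomial)
qed

text \<open>Multiplication by the conjugate symbol is adjoint to multiplication by the symbol.
  Boundedness makes both products square integrable, so neither side is a default value.\<close>

lemma l2_inner_l2_mult_l2_cnj:
  assumes "bounded_symbol \<phi>"
  shows "l2_inner (l2_mult (l2_cnj \<phi>) f) g = l2_inner f (l2_mult \<phi> g)"
proof -
  from assms obtain p where p: "\<phi> = abs_L2 p" "square_integrable p"
    and mult: "\<And>f. square_integrable f \<Longrightarrow> square_integrable (\<lambda>z. p z * f z)"
    by (rule bounded_symbolE) blast
  have cnj_mult: "square_integrable (\<lambda>z. cnj (p z) * f z)" if "square_integrable f" for f
    using square_integrable_cnj[OF mult[OF square_integrable_cnj[OF that]]] by simp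
  show ?thesis
  proof (induction f rule: L2.abs_induct)
    case (1 x)
    show ?case
    proof (induction g rule: L2.abs_induct)
      case (1 y)
      with \<open>L2_rel x x\<close> show ?case
        using p(2) mult[of y] cnj_mult[of x]
        by (simp add: p(1) l2_cnj.abs_eq l2_mult.abs_eq l2_inner.abs_eq L2_rel_refl
            square_integrable_cnj) (simp add: mult_ac)
    qed
  qed
qed

lemma l2_mult_commute: "l2_mult f g = l2_mult g f"
proof transfer
  fix f g :: "('a \<Rightarrow> complex) \<Rightarrow> complex"
  have "(\<lambda>z. f z * g z) = (\<lambda>z. g z * f z)"
    by (simp add: mult.commute)
  then show "L2_rel (if square_integrable (\<lambda>z. f z * g z) then \<lambda>z. f z * g z else (\<lambda>_. 0))
      (if square_integrable (\<lambda>z. g z * f z) then \<lambda>z. g z * f z else (\<lambda>_. 0))"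
    by (auto simp: L2_rel_refl square_integrable_zero)
qed

lemma l2_mult_l2_monomial: "l2_mult (l2_monomial \<alpha>) (l2_monomial \<beta>) = l2_monomial (\<lambda>j. \<alpha> j + \<beta> j)"
proof -
  have "square_integrable (\<lambda>z. monomial \<alpha> z * monomial \<beta> z)"
    by (rule square_integrable_bounded[where B = 1]) (auto simp: norm_mult cmod_monomial)
  then show ?thesis
    by transfer (auto intro!: L2_rel_torusI square_integrable_monomial simp: monomial_add)
qed

text \<open>Distributivity is not read off from \<open>l2_mult\<close>, whose default value spoils
  additivity in general. Instead the monomial is moved to the other side, where the finite sum
  stands alone and sesquilinearity applies.\<close>

lemma l2_mult_fourier_sum_l2_monomial:
  assumes "finite F"
  shows "l2_mult (fourier_sum c F) (l2_monomial \<beta>)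
    = (\<Sum>\<alpha>\<in>F. l2_scale (c \<alpha>) (l2_monomial (\<lambda>j. \<alpha> j + \<beta> j)))"
proof (rule fourier_coeff_inject)
  fix \<gamma>
  let ?e = "l2_monomial \<beta>" and ?e' = "l2_monomial (\<lambda>j. - \<beta> j)"
  \<comment> \<open>A monomial is the conjugate of the one with negated exponents, which brings the
    product into the form required for adjointness.\<close>
  have "l2_mult (l2_cnj ?e') (fourier_sum c F) = l2_mult (fourier_sum c F) ?e"
    by (simp add: l2_cnj_l2_monomial l2_mult_commute)
  then have "fourier_coeff (l2_mult (fourier_sum c F) ?e) \<gamma>
      = l2_inner (fourier_sum c F) (l2_mult ?e' (l2_monomial \<gamma>))"
    using l2_inner_l2_mult_l2_cnj[OF bounded_symbol_l2_monomial, of "\<lambda>j. - \<beta> j" "fourier_sum c F"]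
    by (simp add: fourier_coeff_eq_inner)
  also have "\<dots> = (\<Sum>\<alpha>\<in>F. c \<alpha> * (if \<alpha> = (\<lambda>j. - \<beta> j + \<gamma> j) then 1 else 0))"
    by (simp add: l2_mult_l2_monomial fourier_sum_def l2_inner_sum_left l2_inner_scale_left l2_inner_monomial)
  also have "\<dots> = (\<Sum>\<alpha>\<in>F. c \<alpha> * (if (\<lambda>j. \<alpha> j + \<beta> j) = \<gamma> then 1 else 0))"
    by (intro sum.cong refl arg_cong2[where f = "(*)"] if_cong) (auto simp: fun_eq_iff algebra_simps)
  finally show "fourier_coeff (l2_mult (fourier_sum c F) ?e) \<gamma>
      = fourier_coeff (\<Sum>\<alpha>\<in>F. l2_scale (c \<alpha>) (l2_monomial (\<lambda>j. \<alpha> j + \<beta> j))) \<gamma>"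
    by (simp add: fourier_coeff_sum fourier_coeff_scale)
       (simp add: fourier_coeff_eq_inner l2_inner_monomial)
qed

section \<open>The Hardy spaces as spectral spaces\<close>

definition nonneg_indices :: "('d::finite \<Rightarrow> int) set" where
  "nonneg_indices = {\<alpha>. \<forall>j. 0 \<le> \<alpha> j}"

definition homogeneous_indices :: "nat \<Rightarrow> ('d::finite \<Rightarrow> int) set" where
  "homogeneous_indices m = {\<alpha> \<in> nonneg_indices. (\<Sum>j\<in>UNIV. \<alpha> j) = int m}"

definition reflected :: "('d::finite \<Rightarrow> int) set \<Rightarrow> ('d \<Rightarrow> int) set" where
  "reflected N = {\<alpha>. (\<lambda>j. - \<alpha> j) \<in> N}"

lemma reflected_reflected [simp]: "reflected (reflected N) = N"
  by (simp add: reflected_def)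

lemma finite_bounded_indices: "finite {\<alpha> :: 'd::finite \<Rightarrow> int. \<forall>j. \<alpha> j \<in> {a..b}}"
proof -
  have "finite (\<Pi>\<^sub>E j\<in>(UNIV :: 'd set). {a..b})"
    by (rule finite_PiE) auto
  then show ?thesis by (simp add: PiE_def Pi_def)
qed

lemma homogeneous_indices_le: "\<alpha> \<in> homogeneous_indices m \<Longrightarrow> \<alpha> j \<le> int m"
  using member_le_sum[of j UNIV \<alpha>] by (auto simp: homogeneous_indices_def nonneg_indices_def)

text \<open>All entries lie between 0 and \<open>m\<close>. Hence \<open>H2_hom m\<close> consists
  of trigonometric polynomials, which are bounded symbols.\<close>

lemma finite_homogeneous_indices: "finite (homogeneous_indices m)"
  by (rule finite_subset[OF _ finite_bounded_indices[of 0 "int m"]])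
     (auto simp: homogeneous_indices_le, auto simp: homogeneous_indices_def nonneg_indices_def)

lemma finite_reflected: "finite N \<Longrightarrow> finite (reflected N)"
  unfolding reflected_def using finite_vimageI[of N "\<lambda>\<alpha> j. - \<alpha> j"]
  by (simp add: vimage_def inj_def fun_eq_iff)

lemma H2_eq: "H2 = spectral_space nonneg_indices"
  by (simp add: H2_def spectral_space_def nonneg_indices_def)

lemma H2_hom_eq: "H2_hom m = spectral_space (homogeneous_indices m)"
  by (auto simp: H2_hom_def H2_def homogeneous_def spectral_space_def homogeneous_indices_def
      nonneg_indices_def)

lemma l2_cnj_image_spectral_space: "l2_cnj ` spectral_space N = spectral_space (reflected N)"
proof -
  have "l2_cnj f \<in> spectral_space (reflected N)" if "f \<in> spectral_space N" for f N
    using that by (simp add: spectral_space_def reflected_def fourier_coeff_l2_cnj)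
  from this this[of _ "reflected N"] show ?thesis
    by (auto simp: image_iff) (metis l2_cnj_l2_cnj)
qed

lemma l2_reflect_spectral_space: "f \<in> spectral_space N \<Longrightarrow> l2_reflect f \<in> spectral_space (reflected N)"
  by (simp add: spectral_space_def reflected_def fourier_coeff_l2_reflect)

lemma H2_conj_eq: "H2_conj = spectral_space (reflected nonneg_indices)"
  by (simp add: H2_conj_def H2_eq l2_cnj_image_spectral_space)

lemma H2_conj_hom_eq: "H2_conj_hom m = spectral_space (reflected (homogeneous_indices m))"
  by (simp add: H2_conj_hom_def H2_hom_eq l2_cnj_image_spectral_space)

lemma H2_hom_subset_H2: "H2_hom m \<subseteq> H2"
  by (auto simp: H2_hom_def)

lemma H2_conj_hom_subset_H2_conj: "H2_conj_hom m \<subseteq> H2_conj"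
  using H2_hom_subset_H2 by (auto simp: H2_conj_hom_def H2_conj_def)

lemma l2_reflect_H2: "f \<in> H2 \<Longrightarrow> l2_reflect f \<in> H2_conj"
  unfolding H2_eq H2_conj_eq by (rule l2_reflect_spectral_space)

lemma l2_reflect_H2_hom: "f \<in> H2_hom m \<Longrightarrow> l2_reflect f \<in> H2_conj_hom m"
  unfolding H2_hom_eq H2_conj_hom_eq by (rule l2_reflect_spectral_space)

lemma l2_reflect_H2_conj_hom: "f \<in> H2_conj_hom m \<Longrightarrow> l2_reflect f \<in> H2_hom m"
  unfolding H2_hom_eq H2_conj_hom_eq using l2_reflect_spectral_space[of f] by fastforce

lemma bounded_symbol_H2_hom:
  assumes "\<phi> \<in> H2_hom m"
  shows "bounded_symbol \<phi>"
  using bounded_symbol_fourier_sum[OF finite_homogeneous_indices, of "fourier_coeff \<phi>" m]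
    fourier_sum_eq[OF assms[unfolded H2_hom_eq] finite_homogeneous_indices] by simp

text \<open>Moving the symbol onto the monomial of frequency \<beta> leaves a finite sum of
  monomials of frequency \<alpha> + \<beta>, against which \<open>f\<close> is tested.\<close>

lemma fourier_coeff_l2_mult_l2_cnj:
  assumes "\<phi> \<in> H2_hom m"
  shows "fourier_coeff (l2_mult (l2_cnj \<phi>) f) \<beta>
    = (\<Sum>\<alpha>\<in>homogeneous_indices m. cnj (fourier_coeff \<phi> \<alpha>) * fourier_coeff f (\<lambda>j. \<alpha> j + \<beta> j))"
proof -
  have "fourier_coeff (l2_mult (l2_cnj \<phi>) f) \<beta> = l2_inner f (l2_mult \<phi> (l2_monomial \<beta>))"
    using bounded_symbol_H2_hom[OF assms] by (simp add: fourier_coeff_eq_inner l2_inner_l2_mult_l2_cnj)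
  also have "l2_mult \<phi> (l2_monomial \<beta>)
      = (\<Sum>\<alpha>\<in>homogeneous_indices m. l2_scale (fourier_coeff \<phi> \<alpha>) (l2_monomial (\<lambda>j. \<alpha> j + \<beta> j)))"
    using l2_mult_fourier_sum_l2_monomial[OF finite_homogeneous_indices, of "fourier_coeff \<phi>" m \<beta>]
      fourier_sum_eq[OF assms[unfolded H2_hom_eq] finite_homogeneous_indices] by simp
  also have "l2_inner f \<dots>
      = (\<Sum>\<alpha>\<in>homogeneous_indices m. cnj (fourier_coeff \<phi> \<alpha>) * fourier_coeff f (\<lambda>j. \<alpha> j + \<beta> j))"
    by (simp add: l2_inner_sum_right l2_inner_scale_right fourier_coeff_eq_inner)
  finally show ?thesis .
qed

text \<open>Only finitely many coefficients survive the projection, so it exists without completeness.\<close>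

lemma fourier_coeff_hankel:
  assumes \<phi>: "\<phi> \<in> H2_hom m" and f: "f \<in> H2"
  shows "fourier_coeff (hankel \<phi> f) \<beta> = (if \<beta> \<in> reflected nonneg_indices
    then \<Sum>\<alpha>\<in>homogeneous_indices m. cnj (fourier_coeff \<phi> \<alpha>) * fourier_coeff f (\<lambda>j. \<alpha> j + \<beta> j)
    else 0)"
proof -
  let ?h = "l2_mult (l2_cnj \<phi>) f"
  let ?F = "{\<beta> \<in> reflected nonneg_indices. fourier_coeff ?h \<beta> \<noteq> 0}"
  \<comment> \<open>Some \<alpha> with entries at most \<open>m\<close> has \<alpha> + \<beta> in
    the spectrum of \<open>f\<close>, so \<alpha> + \<beta> has nonnegative entries and \<beta> is
    bounded below by -m; the projection gives the upper bound 0.\<close>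
  have "\<beta> j \<in> {- int m..0}" if "\<beta> \<in> ?F" for \<beta> j
  proof -
    from that have "(\<Sum>\<alpha>\<in>homogeneous_indices m.
        cnj (fourier_coeff \<phi> \<alpha>) * fourier_coeff f (\<lambda>j. \<alpha> j + \<beta> j)) \<noteq> 0"
      by (simp add: fourier_coeff_l2_mult_l2_cnj[OF \<phi>])
    then obtain \<alpha> where \<alpha>: "\<alpha> \<in> homogeneous_indices m" "fourier_coeff f (\<lambda>j. \<alpha> j + \<beta> j) \<noteq> 0"
      by (rule sum.not_neutral_contains_not_neutral) simp
    have "0 \<le> \<alpha> j + \<beta> j"
      using f \<alpha>(2) by (auto simp: H2_def)
    with homogeneous_indices_le[OF \<alpha>(1), of j] that show ?thesis
      by (auto simp: reflected_def nonneg_indices_def)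
  qed
  then have fin: "finite ?F"
    by (intro finite_subset[OF _ finite_bounded_indices[of "- int m" 0]]) blast
  have "hankel \<phi> f = fourier_sum (fourier_coeff ?h) ?F"
    using f by (simp add: hankel_def H2_conj_eq orth_proj_spectral_space[OF fin])
  then show ?thesis
    using fin by (simp add: fourier_coeff_fourier_sum fourier_coeff_l2_mult_l2_cnj[OF \<phi>])
qed

text \<open>Against vectors of \<open>H2_conj\<close> the projection may be dropped: it only removes
  frequencies on which \<open>g\<close> has no coefficient.\<close>

lemma l2_inner_hankel:
  assumes \<phi>: "\<phi> \<in> H2_hom m" and f: "f \<in> H2" and g: "g \<in> H2_conj"
  shows "l2_inner (hankel \<phi> f) g = l2_inner f (l2_mult \<phi> g)"
proof -
  have "l2_inner (hankel \<phi> f - l2_mult (l2_cnj \<phi>) f) g = 0"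
    using g by (intro l2_inner_eq_0)
      (auto simp: fourier_coeff_diff fourier_coeff_hankel[OF \<phi> f] fourier_coeff_l2_mult_l2_cnj[OF \<phi>]
        H2_conj_eq dest: spectral_spaceD)
  then show ?thesis
    by (simp add: l2_inner_diff_left l2_inner_l2_mult_l2_cnj bounded_symbol_H2_hom[OF \<phi>])
qed

text \<open>Additivity is read off from the coefficient formula, since it is visible neither in
  \<open>l2_mult\<close> nor in the description defining \<open>orth_proj\<close>.\<close>

lemma hankel_sum:
  assumes \<phi>: "\<phi> \<in> H2_hom m" and g: "\<And>i. i \<in> I \<Longrightarrow> g i \<in> H2"
  shows "hankel \<phi> (\<Sum>i\<in>I. g i) = (\<Sum>i\<in>I. hankel \<phi> (g i))"
proof (rule fourier_coeff_inject)
  fix \<beta>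
  have "fourier_coeff (\<Sum>i\<in>I. g i) \<alpha> = 0" if "\<alpha> \<notin> nonneg_indices" for \<alpha>
    using g that unfolding fourier_coeff_sum H2_eq by (intro sum.neutral) (auto intro: spectral_spaceD)
  then have "(\<Sum>i\<in>I. g i) \<in> H2"
    by (auto simp: H2_eq spectral_space_def)
  then show "fourier_coeff (hankel \<phi> (\<Sum>i\<in>I. g i)) \<beta> = fourier_coeff (\<Sum>i\<in>I. hankel \<phi> (g i)) \<beta>"
    using g by (simp add: fourier_coeff_sum fourier_coeff_hankel[OF \<phi>] sum_distrib_left
        sum.swap[of _ I])
qed

text \<open>The degree count behind both block statements: an output frequency \<beta> must come
  from an input frequency \<gamma> = \<alpha> + \<beta> with \<alpha> of degree
  \<open>m\<close>.\<close>

lemma fourier_coeff_hankel_nonzero: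
  assumes \<phi>: "\<phi> \<in> H2_hom m" and f: "f \<in> H2" and \<beta>: "fourier_coeff (hankel \<phi> f) \<beta> \<noteq> 0"
  obtains \<gamma> where "fourier_coeff f \<gamma> \<noteq> 0" "(\<Sum>j\<in>UNIV. \<gamma> j) = int m + (\<Sum>j\<in>UNIV. \<beta> j)"
    "\<beta> \<in> reflected nonneg_indices"
proof -
  from \<beta> have r: "\<beta> \<in> reflected nonneg_indices" and "(\<Sum>\<alpha>\<in>homogeneous_indices m.
      cnj (fourier_coeff \<phi> \<alpha>) * fourier_coeff f (\<lambda>j. \<alpha> j + \<beta> j)) \<noteq> 0"
    by (simp_all add: fourier_coeff_hankel[OF \<phi> f] split: if_splits)
  from this(2) obtain \<alpha> where "\<alpha> \<in> homogeneous_indices m" "fourier_coeff f (\<lambda>j. \<alpha> j + \<beta> j) \<noteq> 0"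
    by (rule sum.not_neutral_contains_not_neutral) simp
  with r show ?thesis
    by (intro that[of "\<lambda>j. \<alpha> j + \<beta> j"]) (auto simp: sum.distrib homogeneous_indices_def)
qed

lemma sum_reflected_nonneg_indices: "\<beta> \<in> reflected nonneg_indices \<Longrightarrow> (\<Sum>j\<in>UNIV. \<beta> j) \<le> 0"
  by (auto simp: reflected_def nonneg_indices_def intro: sum_nonpos)

lemma hankel_H2_hom:
  assumes \<phi>: "\<phi> \<in> H2_hom m" and f: "f \<in> H2_hom k" and k: "k \<le> m"
  shows "hankel \<phi> f \<in> H2_conj_hom (m - k)"
  unfolding H2_conj_hom_eq spectral_space_def
proof (intro CollectI allI impI)
  fix \<beta> assume "fourier_coeff (hankel \<phi> f) \<beta> \<noteq> 0"
  with \<phi> H2_hom_subset_H2 f obtain \<gamma> where \<gamma>: "fourier_coeff f \<gamma> \<noteq> 0"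
    "(\<Sum>j\<in>UNIV. \<gamma> j) = int m + (\<Sum>j\<in>UNIV. \<beta> j)" "\<beta> \<in> reflected nonneg_indices"
    by (blast elim: fourier_coeff_hankel_nonzero)
  have "(\<Sum>j\<in>UNIV. \<gamma> j) = int k"
    using f \<gamma>(1) by (auto simp: H2_hom_def homogeneous_def)
  with \<gamma> k show "\<beta> \<in> reflected (homogeneous_indices (m - k))"
    by (auto simp: reflected_def homogeneous_indices_def sum_negf)
qed

text \<open>An input degree above \<open>m\<close> would force a positive output degree, whereas
  frequencies of \<open>H2_conj\<close> have total degree at most 0.\<close>

lemma hankel_eq_0:
  assumes \<phi>: "\<phi> \<in> H2_hom m" and f: "f \<in> spectral_space (\<Union>n\<in>{Suc m..}. homogeneous_indices n)"
  shows "hankel \<phi> f = 0"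
proof (rule fourier_coeff_inject)
  fix \<beta>
  have "f \<in> H2"
    using f by (auto simp: H2_eq spectral_space_def homogeneous_indices_def)
  moreover have "(\<Sum>j\<in>UNIV. \<gamma> j) > int m" if "fourier_coeff f \<gamma> \<noteq> 0" for \<gamma>
    using f that by (force simp: spectral_space_def homogeneous_indices_def)
  ultimately have "fourier_coeff (hankel \<phi> f) \<beta> = 0"
    using sum_reflected_nonneg_indices by (force elim: fourier_coeff_hankel_nonzero[OF \<phi>])
  then show "fourier_coeff (hankel \<phi> f) \<beta> = fourier_coeff 0 \<beta>"
    by simp
qed

section \<open>The orthogonal decomposition\<close>

lemma homogeneous_indices_disjoint: "i \<noteq> j \<Longrightarrow> homogeneous_indices i \<inter> homogeneous_indices j = {}"
  by (auto simp: homogeneous_indices_def)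

lemma UN_homogeneous_indices: "(\<Union>n. homogeneous_indices n) = nonneg_indices"
proof -
  have "\<alpha> \<in> homogeneous_indices (nat (\<Sum>j\<in>UNIV. \<alpha> j))" if "\<alpha> \<in> nonneg_indices" for \<alpha> :: "'a \<Rightarrow> int"
    using that by (auto simp: homogeneous_indices_def nonneg_indices_def sum_nonneg)
  moreover have "homogeneous_indices n \<subseteq> nonneg_indices" for n
    by (auto simp: homogeneous_indices_def)
  ultimately show ?thesis
    by blast
qed

text \<open>The index \<open>Suc m\<close> stands for the zero block, with the sum of all degrees
  above \<open>m\<close> on either side. In the target the blocks 0 to \<open>m\<close> run through
  the degrees in reverse order, and the tail is what is left of \<open>H2_conj\<close>.\<close>

lemma orthogonal_decomposition_hankel:
  assumes \<phi>: "\<phi> \<in> H2_hom m"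
  shows "orthogonal_decomposition H2 H2_conj (hankel \<phi>) {..Suc m}
      (\<lambda>k. if k \<le> m then H2_hom k else hilbert_sum {Suc m..} H2_hom)
      (\<lambda>k. if k \<le> m then H2_conj_hom (m - k) else hilbert_sum {Suc m..} H2_conj_hom)
      (\<lambda>k. if k \<le> m then hankel_hom \<phi> k else (\<lambda>_. 0))"
    (is "orthogonal_decomposition _ _ _ _ ?A ?B ?S")
proof -
  let ?T = "\<Union>n\<in>{Suc m..}. homogeneous_indices n :: ('a \<Rightarrow> int) set"
  define N where "N k = (if k \<le> m then homogeneous_indices k else ?T)" for k
  define N' where "N' k = reflected (if k \<le> m then homogeneous_indices (m - k) else ?T)" for k
  have tail: "hilbert_sum {Suc m..} (\<lambda>n. spectral_space (homogeneous_indices n)) = spectral_space ?T"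
    by (rule hilbert_sum_spectral_space[OF finite_homogeneous_indices homogeneous_indices_disjoint])
  have UN_reflected: "(\<Union>i\<in>I. reflected (M i)) = reflected (\<Union>i\<in>I. M i)" for I :: "nat set" and M
    by (auto simp: reflected_def)
  have disj_reflected: "reflected M \<inter> reflected M' = {}" if "M \<inter> M' = {}" for M M' :: "('a \<Rightarrow> int) set"
    using that by (auto simp: reflected_def)
  have tail': "hilbert_sum {Suc m..} (\<lambda>n. spectral_space (reflected (homogeneous_indices n)))
      = spectral_space (reflected ?T)"
    unfolding UN_reflected[symmetric]
    by (rule hilbert_sum_spectral_space)
       (auto intro!: finite_reflected finite_homogeneous_indices disj_reflected homogeneous_indices_disjoint)
  have H: "H2_hom = (\<lambda>n. spectral_space (homogeneous_indices n) :: 'a L2 set)"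
    "H2_conj_hom = (\<lambda>n. spectral_space (reflected (homogeneous_indices n)) :: 'a L2 set)"
    by (simp_all add: fun_eq_iff H2_hom_eq H2_conj_hom_eq)
  have A: "?A = (\<lambda>k. spectral_space (N k))" and B: "?B = (\<lambda>k. spectral_space (N' k))"
    by (simp_all add: fun_eq_iff N_def N'_def H tail tail')
  have disj: "N i \<inter> N j = {}" "N' i \<inter> N' j = {}" if "i \<in> {..Suc m}" "j \<in> {..Suc m}" "i \<noteq> j" for i j
    using that unfolding N_def N'_def
    by (auto intro!: disj_reflected) (auto simp: homogeneous_indices_def)
  have Suc_m: "{..Suc m} = insert (Suc m) {..m}" "{..m} \<inter> {k. k \<le> m} = {..m}"
    "{..m} \<inter> {k. \<not> k \<le> m} = {}"
    by auto
  have "{..m} \<union> {Suc m..} = UNIV"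
    by auto
  then have UN: "(\<Union>k\<in>{..m}. homogeneous_indices k) \<union> ?T = nonneg_indices"
    by (simp only: UN_homogeneous_indices flip: UN_Un)
  have "(\<Union>k\<in>{..Suc m}. N k) = nonneg_indices"
    by (simp add: Suc_m N_def Un_commute flip: UN)
  moreover have "(\<Union>k\<in>{..Suc m}. N' k) = reflected nonneg_indices"
  proof -
    \<comment> \<open>Reversal of the degrees permutes 0 to \<open>m\<close>, so source and target
      blocks exhaust the same degrees.\<close>
    have "k \<in> (-) m ` {..m}" if "k \<le> m" for k
      using that by (intro image_eqI[of _ _ "m - k"]) auto
    then have "(-) m ` {..m} = {..m}"
      by auto
    then have "(\<Union>k\<in>{..m}. homogeneous_indices (m - k))
        = (\<Union>k\<in>{..m}. homogeneous_indices k :: ('a \<Rightarrow> int) set)"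
      by (metis image_image)
    then show ?thesis
      unfolding N'_def UN_reflected by (simp add: Suc_m Un_commute flip: UN)
  qed
  moreover have "finite (N i)" "finite (N' i)" if "i \<in> {..Suc m}" "i \<noteq> Suc m" for i
    using that by (auto simp: N_def N'_def intro!: finite_reflected finite_homogeneous_indices)
  ultimately have X: "hilbert_sum {..Suc m} ?A = H2" "hilbert_sum {..Suc m} ?B = H2_conj"
    unfolding A B H2_eq H2_conj_eq
    using hilbert_sum_spectral_space_finite[of "{..Suc m}" "Suc m" N]
      hilbert_sum_spectral_space_finite[of "{..Suc m}" "Suc m" N'] disj by auto
  \<comment> \<open>Every block operator agrees with \<open>hankel \<phi>\<close> on its block, on
    the tail because both vanish. Blockwise action then reduces to finite additivity.\<close>
  have S: "?S i f = hankel \<phi> f" and sub: "f \<in> H2" if "i \<in> {..Suc m}" "f \<in> ?A i" for i f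
  proof -
    have f: "f \<in> spectral_space (N i)"
      using that(2) by (simp only: fun_cong[OF A])
    then show "?S i f = hankel \<phi> f"
      using hankel_eq_0[OF \<phi>, of f] by (simp add: N_def hankel_hom_def H2_hom_eq split: if_splits)
    have "N i \<subseteq> nonneg_indices"
      by (auto simp: N_def homogeneous_indices_def)
    with f show "f \<in> H2"
      unfolding H2_eq using spectral_space_mono by blast
  qed
  show ?thesis
    unfolding orthogonal_decomposition_def
  proof (intro conjI ballI allI impI)
    show "orthogonal_family {..Suc m} ?A" "orthogonal_family {..Suc m} ?B"
      unfolding A B using disj by (intro orthogonal_family_spectral_space; blast)+
    show "H2 = hilbert_sum {..Suc m} ?A" "H2_conj = hilbert_sum {..Suc m} ?B"
      using X by simp_all
    show "?S i ` ?A i \<subseteq> ?B i" if "i \<in> {..Suc m}" for i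
    proof (cases "i \<le> m")
      case True
      then show ?thesis
        using hankel_H2_hom[OF \<phi>] by (auto simp: hankel_hom_def)
    next
      case False
      have "0 \<in> spectral_space (reflected ?T)"
        by (simp add: spectral_space_def)
      with False show ?thesis
        by (auto simp: H tail')
    qed
    fix g f assume gf: "(\<forall>i\<in>{..Suc m}. g i \<in> ?A i) \<and> (g has_sum f) {..Suc m}"
    have g: "g i \<in> ?A i" if "i \<in> {..Suc m}" for i
      using conjunct1[OF gf] that by (rule bspec)
    have f: "f = sum g {..Suc m}"
      using conjunct2[OF gf] has_sum_finite[OF finite_atMost] by (rule has_sum_unique)
    have "hankel \<phi> f = (\<Sum>i\<in>{..Suc m}. hankel \<phi> (g i))"
      unfolding f by (rule hankel_sum[OF \<phi> sub[OF _ g]])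
    also have "\<dots> = (\<Sum>i\<in>{..Suc m}. ?S i (g i))"
      by (rule sum.cong[OF refl S[OF _ g, symmetric]])
    finally show "((\<lambda>i. ?S i (g i)) has_sum hankel \<phi> f) {..Suc m}"
      by (intro has_sum_finiteI) simp_all
  qed
qed

section \<open>The adjoint and the unitary equivalence\<close>

lemma l2_tilde_H2_hom: "\<phi> \<in> H2_hom m \<Longrightarrow> l2_tilde \<phi> \<in> H2_hom m"
  by (simp add: H2_hom_eq spectral_space_def fourier_coeff_l2_tilde)

text \<open>Reflection is a linear isometric involution, so mapping each space into the other
  already gives surjectivity.\<close>

lemma unitary_on_l2_reflect:
  assumes "\<And>f. f \<in> X \<Longrightarrow> l2_reflect f \<in> Y" "\<And>f. f \<in> Y \<Longrightarrow> l2_reflect f \<in> X"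
  shows "unitary_on X Y l2_reflect"
proof -
  have "l2_reflect ` X = Y"
    using assms l2_reflect_l2_reflect by (metis image_subset_iff subsetI subset_antisym image_eqI)
  then show ?thesis
    by (simp add: unitary_on_def clinear_on_def l2_reflect_add l2_reflect_scale l2_inner_l2_reflect)
qed

lemma adjoint_hankel_hom:
  assumes \<phi>: "\<phi> \<in> H2_hom m" and k: "k \<le> m" and g: "g \<in> H2_conj_hom (m - k)"
  shows "adjoint_on (H2_hom k) (H2_conj_hom (m - k)) (hankel_hom \<phi> k) g
    = l2_reflect (hankel (l2_tilde \<phi>) (l2_reflect g))"
proof -
  let ?f = "l2_reflect (hankel (l2_tilde \<phi>) (l2_reflect g))"
  have t: "l2_tilde \<phi> \<in> H2_hom m" using \<phi> by (rule l2_tilde_H2_hom)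
  have Rg: "l2_reflect g \<in> H2_hom (m - k)"
    using g by (rule l2_reflect_H2_conj_hom)
  have f: "?f \<in> H2_hom k"
    using l2_reflect_H2_conj_hom[OF hankel_H2_hom[OF t Rg]] k by simp
  have adj: "l2_inner (hankel_hom \<phi> k h) g = l2_inner h ?f" if h: "h \<in> H2_hom k" for h
  proof -
    have h': "h \<in> H2" and g': "g \<in> H2_conj" and Rg': "l2_reflect g \<in> H2"
      using h g Rg H2_hom_subset_H2 H2_conj_hom_subset_H2_conj by blast+
    have "l2_inner h ?f = l2_inner (l2_reflect h) (hankel (l2_tilde \<phi>) (l2_reflect g))"
      using l2_inner_l2_reflect[of "l2_reflect h"] by (simp add: l2_reflect_l2_reflect)
    also have "\<dots> = l2_inner (l2_mult (l2_tilde \<phi>) (l2_reflect h)) (l2_reflect g)"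
      by (subst (1 2) l2_inner_commute) (simp add: l2_inner_hankel[OF t Rg' l2_reflect_H2[OF h']])
    also have "\<dots> = l2_inner (l2_reflect (l2_mult (l2_cnj \<phi>) h)) (l2_reflect g)"
    proof -
      \<comment> \<open>This identity turns the product of two reflections into the reflection of
        one product, after which isometry removes both reflections.\<close>
      have "l2_tilde \<phi> = l2_reflect (l2_cnj \<phi>)"
        by (rule fourier_coeff_inject)
           (simp add: fourier_coeff_l2_tilde fourier_coeff_l2_reflect fourier_coeff_l2_cnj)
      then show ?thesis by (simp add: l2_mult_l2_reflect)
    qed
    also have "\<dots> = l2_inner h (l2_mult \<phi> g)"
      by (simp add: l2_inner_l2_reflect l2_inner_l2_mult_l2_cnj[OF bounded_symbol_H2_hom[OF \<phi>]])
    also have "\<dots> = l2_inner (hankel_hom \<phi> k h) g"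
      using h by (simp add: hankel_hom_def l2_inner_hankel[OF \<phi> h' g'])
    finally show ?thesis ..
  qed
  have "(THE f. f \<in> H2_hom k \<and> (\<forall>h\<in>H2_hom k. l2_inner (hankel_hom \<phi> k h) g = l2_inner h f)) = ?f"
  proof (rule the_equality)
    show "?f \<in> H2_hom k \<and> (\<forall>h\<in>H2_hom k. l2_inner (hankel_hom \<phi> k h) g = l2_inner h ?f)"
      using f adj by blast
    fix f' assume f': "f' \<in> H2_hom k \<and> (\<forall>h\<in>H2_hom k. l2_inner (hankel_hom \<phi> k h) g = l2_inner h f')"
    show "f' = ?f"
    proof (rule fourier_coeff_inject)
      fix \<alpha>
      show "fourier_coeff f' \<alpha> = fourier_coeff ?f \<alpha>"
      proof (cases "\<alpha> \<in> homogeneous_indices k")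
        case True
        then have "l2_monomial \<alpha> \<in> H2_hom k"
          by (simp add: H2_hom_eq l2_monomial_spectral_space)
        \<comment> \<open>Monomials of \<open>H2_hom k\<close> detect all its coefficients; this is
          the uniqueness required by the description in \<open>adjoint_on\<close>.\<close>
        then have "l2_inner (l2_monomial \<alpha>) f' = l2_inner (l2_monomial \<alpha>) ?f"
          using f' adj by metis
        then show ?thesis
          unfolding fourier_coeff_eq_inner by (metis l2_inner_commute)
      next
        case False
        then show ?thesis
          using f f' unfolding H2_hom_eq by (metis spectral_spaceD)
      qed
    qed
  qed
  then show ?thesis
    using g by (simp add: adjoint_on_def)
qed

theorem theorem4:
  fixes \<phi> :: "'d::finite L2" and m :: nat
  assumes "\<phi> \<in> H2_hom m"
  shows "(\<forall>k\<le>m. hankel_hom \<phi> k ` H2_hom k \<subseteq> H2_conj_hom (m - k)) \<and>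
    orthogonal_decomposition H2 H2_conj (hankel \<phi>) {..Suc m}
      (\<lambda>k. if k \<le> m then H2_hom k else hilbert_sum {Suc m..} H2_hom)
      (\<lambda>k. if k \<le> m then H2_conj_hom (m - k) else hilbert_sum {Suc m..} H2_conj_hom)
      (\<lambda>k. if k \<le> m then hankel_hom \<phi> k else (\<lambda>_. 0)) \<and>
    (\<forall>k\<le>m. unitarily_equivalent
      (H2_conj_hom (m - k)) (H2_hom k) (adjoint_on (H2_hom k) (H2_conj_hom (m - k)) (hankel_hom \<phi> k))
      (H2_hom (m - k)) (H2_conj_hom (m - (m - k))) (hankel_hom (l2_tilde \<phi>) (m - k)))"
proof (intro conjI allI impI)
  fix k assume k: "k \<le> m"
  show "hankel_hom \<phi> k ` H2_hom k \<subseteq> H2_conj_hom (m - k)"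
    using hankel_H2_hom[OF assms _ k] by (auto simp: hankel_hom_def)
  \<comment> \<open>Reflection serves as both unitaries. The second target is written with
    \<open>m - (m - k)\<close>, which equals \<open>k\<close> because
    \<open>k \<le> m\<close>.\<close>
  have "unitary_on (H2_conj_hom (m - k)) (H2_hom (m - k)) l2_reflect"
    by (intro unitary_on_l2_reflect l2_reflect_H2_hom l2_reflect_H2_conj_hom)
  moreover have "unitary_on (H2_hom k) (H2_conj_hom (m - (m - k))) l2_reflect"
    using k by (intro unitary_on_l2_reflect) (simp_all add: l2_reflect_H2_hom l2_reflect_H2_conj_hom)
  moreover have "l2_reflect (adjoint_on (H2_hom k) (H2_conj_hom (m - k)) (hankel_hom \<phi> k) g)
      = hankel_hom (l2_tilde \<phi>) (m - k) (l2_reflect g)" if "g \<in> H2_conj_hom (m - k)" for g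
    using l2_reflect_H2_conj_hom[OF that]
    unfolding adjoint_hankel_hom[OF assms k that] by (simp add: l2_reflect_l2_reflect hankel_hom_def)
  ultimately show "unitarily_equivalent
      (H2_conj_hom (m - k)) (H2_hom k) (adjoint_on (H2_hom k) (H2_conj_hom (m - k)) (hankel_hom \<phi> k))
      (H2_hom (m - k)) (H2_conj_hom (m - (m - k))) (hankel_hom (l2_tilde \<phi>) (m - k))"
    unfolding unitarily_equivalent_def by blast
qed (rule orthogonal_decomposition_hankel[OF assms])

end
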